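(* Let $U,V$ be Euclidean spaces and let $J:U\to\mathbb{R}\cup\{+\infty\}$ and $H:V\to\mathbb{R}$ be proper, lower semicontinuous, convex, piecewise linear-quadratic functions. Let $A:U\to V$ be a linear mapping, $B:=\partial(J^*\circ(-A^T))$, $D:=\partial H^*$, fix $\eta>0$ and let $T:=\tfrac12(R_{\eta B}R_{\eta D}+\mathrm{Id}):V\to V$. Suppose that there exists a solution to $0\in(B+D)(x)$, that $T:W\to W$ for some affine subspace $W$ of $V$, and that $\mathrm{Fix}\,T\cap W$ is an isolated point $\{\bar x\}$. Then there is a neighborhood $\mathcal{O}$ of $\bar x$ such that, for all starting points $(x^0,v^0,b^0)$ with $x^0=b^0+\eta v^0\in\mathcal{O}\cap W$ for $v^0\in D(b^0)$ (so that $\mathcal{J}_{\eta D}x^0=b^0$), the sequence $(x^k)_{k\in\mathbb{N}}$ generated by $x^{k+1}=Tx^k$ converges linearly to $\bar x$, where $\bar b:=\mathcal{J}_{\eta D}\bar x$ is a solution of the dual problem $\min_{v\in V}J^*(-A^Tv)+H^*(v)$. The rate of linear convergence is bounded above by $\sqrt{1-\kappa}$, where $\kappa=c^{-2}>0$ for $c$ a constant of metric subregularity of $\mathrm{Id}-T$ (as a mapping $W\to W-\bar x$) at $\bar x$ for $0$ on the neighborhood $\mathcal{O}$ relative to $W$. Moreover, the sequence $(b^k,v^k)_{k\in\mathbb{N}}$ generated by the ADMM iteration (see context) started at $(v^0,b^0)$ converges linearly to $(\bar b,\bar v)$ with $\bar v=\tfrac1\eta(\bar x-\bar b)$, and the ADMM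 sequence $(u^k)_{k\in\mathbb{N}}$ converges to a solution of the primal problem $\min_{u\in U}J(u)+H(Au)$.
   Context: $f^*(y)=\sup_x\{\langle y,x\rangle-f(x)\}$ is the Fenchel conjugate, $\partial f$ the convex subdifferential. The resolvent of a set-valued $\Phi$ is $\mathcal{J}_\Phi=(\mathrm{Id}+\Phi)^{-1}$ and $R_{\eta\Phi}=2\mathcal{J}_{\eta\Phi}-\mathrm{Id}$; for the given $B,D$ these are single-valued. $\mathrm{Fix}\,T=\{x:x\in Tx\}$. A function $f:\mathbb{R}^n\to[-\infty,+\infty]$ is piecewise linear-quadratic if $\mathrm{dom} f$ can be represented as the union of finitely many polyhedral sets, relative to each of which $f(x)=\tfrac12\langle x,Qx\rangle+\langle a,x\rangle+\alpha$ for some $\alpha\in\mathbb{R}$, $a\in\mathbb{R}^n$ and symmetric $Q\in\mathbb{R}^{n\times n}$. A mapping $\Phi$ is metrically subregular at $\bar x$ for $\bar y$ relative to a set $W$ with constant $c>0$ on a neighborhood $\mathcal{O}$ of $\bar x$ if $\bar y\in\Phi(\bar x)$ and $\mathrm{dist}(x,\Phi^{-1}(\bar y)\cap W)\le c\,\mathrm{dist}(\bar y,\Phi(x))$ for all $x\in\mathcal{O}\cap W$. Such a constant may always be enlarged, so $c\ge1$, i.e. $\kappa\le1$, can always be arranged. ADMM iteration with parameter $\eta$, started at $(v^0,b^0)$: for $k=0,1,2,\dots$ $$u^{k+1}\in\mathrm{argmin}_u\{J(u)+\langle b^k,Au\rangle+\tfrac{\eta}{2}\|Au-v^k\|^2\},$$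 $$v^{k+1}\in\mathrm{argmin}_v\{H(v)-\langle b^k,v\rangle+\tfrac{\eta}{2}\|Au^{k+1}-v\|^2\},$$ $$b^{k+1}=b^k+\eta(Au^{k+1}-v^{k+1}).$$ A sequence $(z^k)$ converges linearly to $\bar z$ with rate $r$ if $\|z^k-\bar z\|\le Lr^k$ for some constant $L$ and all $k$.
   Formalization: Convergence of (u^k) to a primal solution is claimed only if the u-subproblem at (b̄, v̄) has at most one minimizer (it fails for J=0, A=0, H=v²/2, η=1, u^k=(−1)^k); in general only the distance of u^k to the set of primal solutions is shown to tend to 0. *)

theory Defs
  imports "HOL-Analysis.Analysis"
begin

section \<open>Extended-real-valued convex functions\<close>

definition edom :: "('a \<Rightarrow> ereal) \<Rightarrow> 'a set" where
  "edom f = {x. f x < \<infinity>}"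

definition proper_fun :: "('a \<Rightarrow> ereal) \<Rightarrow> bool" where
  "proper_fun f \<longleftrightarrow> (\<forall>x. f x \<noteq> -\<infinity>) \<and> edom f \<noteq> {}"

definition lsc :: "('a::topological_space \<Rightarrow> ereal) \<Rightarrow> bool" where
  "lsc f \<longleftrightarrow> (\<forall>x. f x \<le> Liminf (at x) f)"

text \<open>The library's \<^term>\<open>epigraph\<close> is for real-valued functions only; convexity is
  convexity of the epigraph, whose second coordinate is real.\<close>

definition convex_efun :: "('a::real_vector \<Rightarrow> ereal) \<Rightarrow> bool" where
  "convex_efun f \<longleftrightarrow> convex {(x, r::real). f x \<le> ereal r}"

definition piecewise_linear_quadratic :: "('a::euclidean_space \<Rightarrow> ereal) \<Rightarrow> bool" where
  "piecewise_linear_quadratic f \<longleftrightarrow>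
    (\<exists>\<C>. finite \<C> \<and> (\<forall>C\<in>\<C>. polyhedron C) \<and> edom f = \<Union>\<C> \<and>
      (\<forall>C\<in>\<C>. \<exists>(Q::'a \<Rightarrow> 'a) a \<alpha>.
          linear Q \<and> (\<forall>x y. Q x \<bullet> y = x \<bullet> Q y) \<and>
          (\<forall>x\<in>C. f x = ereal (1/2 * (x \<bullet> Q x) + a \<bullet> x + \<alpha>))))"

definition conjugate :: "('a::real_inner \<Rightarrow> ereal) \<Rightarrow> 'a \<Rightarrow> ereal" where
  "conjugate f y = (SUP x. ereal (y \<bullet> x) - f x)"

text \<open>As usual, there are no subgradients at points where \<open>f\<close> is not finite.\<close>

definition subdifferential :: "('a::real_inner \<Rightarrow> ereal) \<Rightarrow> 'a \<Rightarrow> 'a set" where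
  "subdifferential f x = {g. \<bar>f x\<bar> \<noteq> \<infinity> \<and> (\<forall>y. f x + ereal (g \<bullet> (y - x)) \<le> f y)}"

definition argmin_set :: "('a \<Rightarrow> 'b::linorder) \<Rightarrow> 'a set" where
  "argmin_set f = {x. is_arg_min f (\<lambda>_. True) x}"


section \<open>Set-valued mappings\<close>

text \<open>A set-valued mapping is a function into sets; \<open>T\<close> is single-valued at \<open>x\<close> if \<open>T x\<close> is a
  singleton, and then \<open>y \<in> T x\<close> reads \<open>y = T x\<close>.\<close>

definition scale_map :: "real \<Rightarrow> ('a \<Rightarrow> 'b::real_vector set) \<Rightarrow> 'a \<Rightarrow> 'b set" where
  "scale_map \<eta> \<Phi> x = (\<lambda>y. \<eta> *\<^sub>R y) ` \<Phi> x"

definition inv_map :: "('a \<Rightarrow> 'b set) \<Rightarrow> 'b \<Rightarrow> 'a set" where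
  "inv_map \<Phi> y = {x. y \<in> \<Phi> x}"

definition resolvent :: "('a::real_vector \<Rightarrow> 'a set) \<Rightarrow> 'a \<Rightarrow> 'a set" where
  "resolvent \<Phi> = inv_map (\<lambda>z. {z} + \<Phi> z)"

definition reflected_resolvent :: "('a::real_vector \<Rightarrow> 'a set) \<Rightarrow> 'a \<Rightarrow> 'a set" where
  "reflected_resolvent \<Phi> x = (\<lambda>z. 2 *\<^sub>R z - x) ` resolvent \<Phi> x"

definition DR_map ::
    "real \<Rightarrow> ('a::real_vector \<Rightarrow> 'a set) \<Rightarrow> ('a \<Rightarrow> 'a set) \<Rightarrow> 'a \<Rightarrow> 'a set" where
  "DR_map \<eta> B D x =
    (\<lambda>z. (1/2) *\<^sub>R (z + x)) `
      (\<Union>y\<in>reflected_resolvent (scale_map \<eta> D) x. reflected_resolvent (scale_map \<eta> B) y)"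

definition Fix :: "('a \<Rightarrow> 'a set) \<Rightarrow> 'a set" where
  "Fix T = {x. x \<in> T x}"

definition id_minus :: "('a::real_vector \<Rightarrow> 'a set) \<Rightarrow> 'a \<Rightarrow> 'a set" where
  "id_minus T x = (\<lambda>t. x - t) ` T x"

text \<open>Distance to a set with the convention that the distance to the empty set is \<open>\<infinity>\<close>
  (the library's \<^term>\<open>infdist\<close> gives \<open>0\<close> there).\<close>

definition edist_set :: "'a::metric_space \<Rightarrow> 'a set \<Rightarrow> ereal" where
  "edist_set x S = (INF y\<in>S. ereal (dist x y))"

definition metrically_subregular ::
    "('a::metric_space \<Rightarrow> 'b::metric_space set) \<Rightarrow> 'a \<Rightarrow> 'b \<Rightarrow> 'a set \<Rightarrow> real \<Rightarrow> 'a set \<Rightarrow> bool" where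
  "metrically_subregular \<Phi> xbar ybar W c N \<longleftrightarrow>
    c > 0 \<and> xbar \<in> interior N \<and> ybar \<in> \<Phi> xbar \<and>
    (\<forall>x\<in>N \<inter> W. edist_set x (inv_map \<Phi> ybar \<inter> W) \<le> ereal c * edist_set ybar (\<Phi> x))"


section \<open>Linear convergence\<close>

definition linear_rate :: "(nat \<Rightarrow> 'a::real_normed_vector) \<Rightarrow> 'a \<Rightarrow> real \<Rightarrow> bool" where
  "linear_rate z zbar r \<longleftrightarrow> (\<exists>L. \<forall>k. norm (z k - zbar) \<le> L * r ^ k)"

definition converges_linearly :: "(nat \<Rightarrow> 'a::real_normed_vector) \<Rightarrow> 'a \<Rightarrow> bool" where
  "converges_linearly z zbar \<longleftrightarrow> (\<exists>r. 0 \<le> r \<and> r < 1 \<and> linear_rate z zbar r)"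


section \<open>The primal and dual problems and the ADMM iteration\<close>

definition primal_solutions ::
    "('u \<Rightarrow> ereal) \<Rightarrow> ('v \<Rightarrow> real) \<Rightarrow> ('u \<Rightarrow> 'v) \<Rightarrow> 'u set" where
  "primal_solutions J H A = argmin_set (\<lambda>u. J u + ereal (H (A u)))"

definition dual_solutions ::
    "('u::euclidean_space \<Rightarrow> ereal) \<Rightarrow> ('v::euclidean_space \<Rightarrow> real) \<Rightarrow> ('u \<Rightarrow> 'v) \<Rightarrow> 'v set" where
  "dual_solutions J H A =
    argmin_set (\<lambda>v. conjugate J (- adjoint A v) + conjugate (\<lambda>w. ereal (H w)) v)"

definition admm_u_step ::
    "('u \<Rightarrow> ereal) \<Rightarrow> ('u \<Rightarrow> 'v::euclidean_space) \<Rightarrow> real \<Rightarrow> 'v \<Rightarrow> 'v \<Rightarrow> 'u set" where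
  "admm_u_step J A \<eta> b v =
    argmin_set (\<lambda>u. J u + ereal (b \<bullet> A u) + ereal (\<eta>/2 * (norm (A u - v))\<^sup>2))"

definition admm_v_step ::
    "('v::euclidean_space \<Rightarrow> real) \<Rightarrow> ('u \<Rightarrow> 'v) \<Rightarrow> real \<Rightarrow> 'v \<Rightarrow> 'u \<Rightarrow> 'v set" where
  "admm_v_step H A \<eta> b u =
    argmin_set (\<lambda>v. H v - b \<bullet> v + \<eta>/2 * (norm (A u - v))\<^sup>2)"

text \<open>The value \<open>u 0\<close> plays no role.\<close>

definition admm_sequence ::
    "('u \<Rightarrow> ereal) \<Rightarrow> ('v::euclidean_space \<Rightarrow> real) \<Rightarrow> ('u \<Rightarrow> 'v) \<Rightarrow> real \<Rightarrow>
     (nat \<Rightarrow> 'u) \<Rightarrow> (nat \<Rightarrow> 'v) \<Rightarrow> (nat \<Rightarrow> 'v) \<Rightarrow> bool" where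
  "admm_sequence J H A \<eta> u v b \<longleftrightarrow>
    (\<forall>k. u (Suc k) \<in> admm_u_step J A \<eta> (b k) (v k) \<and>
         v (Suc k) \<in> admm_v_step H A \<eta> (b k) (u (Suc k)) \<and>
         b (Suc k) = b k + \<eta> *\<^sub>R (A (u (Suc k)) - v (Suc k)))"

end

theory Submission
  imports Defs
begin

text \<open>The graph of the subdifferential of a convex piecewise linear-quadratic function is a finite
  union of polyhedra, and so is the graph of \<open>T\<close>, which is a linear image of an intersection of
  such graphs. Polyhedra are locally cones, so an isolated fixed point of \<open>T\<close> in \<open>W\<close> satisfies a
  linear error bound; combined with firm nonexpansiveness it contracts the distance to the fixed
  point in every step. The graph of \<open>B\<close> is described through \<open>J\<close> alone by solving the ADMM
  subproblem, whose solvability follows from the Frank-Wolfe theorem.\<close>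

section \<open>Polyhedra under linear maps\<close>

text \<open>A solution of \<open>0 \<in> B x + D x\<close> makes both subdifferentials nonempty at
  one point. The conjugates are finite there, and a finite value of the conjugate of
  \<open>J\<close> at \<open>- adjoint A z\<close> is an affine minorant of \<open>J\<close>. It
  bounds the ADMM objective below on each piece, which is what the Frank-Wolfe theorem asks for.

  The optimality conditions of a piecewise function read "outside the piece \<open>C\<close>, or in
  the normal cone relation of \<open>C\<close>", and being outside is an open condition. Hence the
  graph first comes out as a union of sets with strict inequalities; since the graph itself is
  closed, their closures may be taken instead.

  The minimisers of the u-step need not be unique: for \<open>J = 0\<close> and \<open>A = 0\<close>
  every point is one, and the \<open>u\<close>-iterates can wander. What holds in general is that
  their distance to the primal solutions vanishes, because points of a polyhedral relation approach
  its section over the limit of their parameters. The iterates themselves converge once the u-step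
  at the limit has only one minimiser.\<close>

lemma polyhedron_iff_inequalities:
  fixes S :: "'a::euclidean_space set"
  shows "polyhedron S \<longleftrightarrow> (\<exists>F. finite F \<and> S = {x. \<forall>(a,b)\<in>F. a \<bullet> x \<le> b})"
proof
  assume "polyhedron S"
  then obtain F where F: "finite F" "S = \<Inter>F" "\<forall>h\<in>F. \<exists>a b. a \<noteq> 0 \<and> h = {x. a \<bullet> x \<le> b}"
    unfolding polyhedron_def by blast
  then obtain a b where ab: "\<And>h. h \<in> F \<Longrightarrow> h = {x. a h \<bullet> x \<le> b h}"
    by metis
  have "S = {x. \<forall>h\<in>F. a h \<bullet> x \<le> b h}"
    using F(2) ab by blast
  also have "\<dots> = {x. \<forall>(a,b)\<in>(\<lambda>h. (a h, b h)) ` F. a \<bullet> x \<le> b}"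
    by auto
  finally show "\<exists>F. finite F \<and> S = {x. \<forall>(a,b)\<in>F. a \<bullet> x \<le> b}"
    using F(1) by blast
next
  assume "\<exists>F. finite F \<and> S = {x. \<forall>(a,b)\<in>F. a \<bullet> x \<le> b}"
  then obtain F where F: "finite F" "S = {x. \<forall>(a,b)\<in>F. a \<bullet> x \<le> b}"
    by blast
  have "S = \<Inter> ((\<lambda>(a,b). {x. a \<bullet> x \<le> b}) ` F)"
    unfolding F(2) by auto
  then show "polyhedron S"
    using F(1) by (auto intro!: polyhedron_Inter polyhedron_halfspace_le)
qed

lemma polyhedron_affine_vimage:
  fixes S :: "'b::euclidean_space set" and l :: "'a::euclidean_space \<Rightarrow> 'b"
  assumes S: "polyhedron S" and l: "linear l"
  shows "polyhedron {x. l x + c \<in> S}"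
proof -
  obtain F where F: "finite F" "S = {x. \<forall>(a,b)\<in>F. a \<bullet> x \<le> b}"
    using S polyhedron_iff_inequalities by blast
  have eq: "a \<bullet> l x = adjoint l a \<bullet> x" for a x
    using adjoint_works[OF l, of x a] by (simp add: inner_commute)
  have "{x. l x + c \<in> S} = {x. \<forall>(a,b)\<in>(\<lambda>(a,b). (adjoint l a, b - a \<bullet> c)) ` F. a \<bullet> x \<le> b}"
    unfolding F(2) by (auto simp: inner_add_right eq split_beta algebra_simps)
  then show ?thesis
    unfolding polyhedron_iff_inequalities using F(1) by blast
qed

lemma polyhedron_linear_vimage:
  fixes S :: "'b::euclidean_space set" and l :: "'a::euclidean_space \<Rightarrow> 'b"
  assumes "polyhedron S" "linear l"
  shows "polyhedron {x. l x \<in> S}"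
  using polyhedron_affine_vimage[OF assms, of 0] by simp

lemma polyhedron_Times:
  fixes S :: "'a::euclidean_space set" and T :: "'b::euclidean_space set"
  assumes "polyhedron S" "polyhedron T"
  shows "polyhedron (S \<times> T)"
proof -
  have "S \<times> T = {x. fst x \<in> S} \<inter> {x. snd x \<in> T}"
    by auto
  then show ?thesis
    using assms by (simp add: polyhedron_linear_vimage linear_fst linear_snd)
qed

text \<open>Supplies the parameter in Fourier-Motzkin elimination. The largest lower bound serves as
  \<open>t\<close>; without lower bounds the smallest upper bound does.\<close>

lemma finite_separation:
  fixes L U :: "real set"
  assumes "finite L" "finite U" "\<And>l u. l \<in> L \<Longrightarrow> u \<in> U \<Longrightarrow> l \<le> u"
  shows "\<exists>t. (\<forall>l\<in>L. l \<le> t) \<and> (\<forall>u\<in>U. t \<le> u)"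
proof (cases "L = {}")
  case True
  then show ?thesis
    using assms(2) by (cases "U = {}") (auto intro: Min_le)
next
  case False
  then show ?thesis
    using assms by (intro exI[of _ "Max L"]) auto
qed

text \<open>Fourier-Motzkin elimination of the parameter \<open>t\<close>.\<close>

lemma polyhedron_shadow:
  fixes S :: "'a::euclidean_space set"
  assumes "polyhedron S"
  shows "polyhedron {x. \<exists>t::real. x + t *\<^sub>R d \<in> S}"
proof -
  obtain F where F: "finite F" "S = {x. \<forall>(a,b)\<in>F. a \<bullet> x \<le> b}"
    using assms polyhedron_iff_inequalities by blast
  define Z where "Z = {(a,b)\<in>F. a \<bullet> d = 0}"
  define P where "P = {(a,b)\<in>F. a \<bullet> d > 0}"
  define N where "N = {(a,b)\<in>F. a \<bullet> d < 0}"
  have fin: "finite Z" "finite P" "finite N"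
    using F(1) by (auto simp: Z_def P_def N_def intro: rev_finite_subset)
  have FZ: "F = Z \<union> P \<union> N"
    by (auto simp: Z_def P_def N_def)
  \<comment> \<open>Adds a row with positive and a row with negative coefficient along
    \<open>d\<close>, with positive multipliers chosen so that the coefficient of \<open>t\<close>
    cancels.\<close>
  define comb :: "('a \<times> real) \<times> ('a \<times> real) \<Rightarrow> 'a \<times> real" where
    "comb = (\<lambda>((a,b),(a',b')). ((a \<bullet> d) *\<^sub>R a' - (a' \<bullet> d) *\<^sub>R a, (a \<bullet> d) * b' - (a' \<bullet> d) * b))"
  have "(\<exists>t. x + t *\<^sub>R d \<in> S) \<longleftrightarrow> (\<forall>(a,b)\<in>Z \<union> comb ` (P \<times> N). a \<bullet> x \<le> b)" (is "?l \<longleftrightarrow> ?r") for x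
  proof
    assume ?l
    then obtain t where t: "\<And>a b. (a,b) \<in> F \<Longrightarrow> a \<bullet> x + t * (a \<bullet> d) \<le> b"
      by (auto simp: F(2) inner_add_right)
    have "a \<bullet> x \<le> b" if "(a,b) \<in> Z" for a b
      using t[of a b] that by (auto simp: Z_def)
    moreover have "(a \<bullet> d) * (a' \<bullet> x) - (a' \<bullet> d) * (a \<bullet> x) \<le> (a \<bullet> d) * b' - (a' \<bullet> d) * b"
      if "(a,b) \<in> P" "(a',b') \<in> N" for a b a' b'
    proof -
      have "(a \<bullet> d) * (a' \<bullet> x + t * (a' \<bullet> d)) \<le> (a \<bullet> d) * b'"
        using t[of a' b'] that by (intro mult_left_mono) (auto simp: P_def N_def)
      moreover have "- (a' \<bullet> d) * (a \<bullet> x + t * (a \<bullet> d)) \<le> - (a' \<bullet> d) * b"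
        using t[of a b] that by (intro mult_left_mono) (auto simp: P_def N_def)
      ultimately show ?thesis
        by (simp add: algebra_simps)
    qed
    ultimately show ?r
      by (auto simp: comb_def inner_diff_left)
  next
    assume r: ?r
    \<comment> \<open>The value of \<open>t\<close> at which the row becomes tight: an upper bound
      for \<open>t\<close> if the row is in \<open>P\<close>, a lower bound if it is in
      \<open>N\<close>.\<close>
    define g where "g = (\<lambda>(a,b). (b - a \<bullet> x) / (a \<bullet> d))"
    have "g n \<le> g p" if "n \<in> N" "p \<in> P" for n p
    proof -
      obtain a b a' b' where [simp]: "p = (a,b)" "n = (a',b')"
        by (metis surj_pair)
      have d: "a \<bullet> d > 0" "a' \<bullet> d < 0"
        using that by (auto simp: P_def N_def)
      have "comb (p,n) \<in> Z \<union> comb ` (P \<times> N)"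
        using that by blast
      from bspec[OF r this] have "(a \<bullet> d) * (a' \<bullet> x) - (a' \<bullet> d) * (a \<bullet> x) \<le> (a \<bullet> d) * b' - (a' \<bullet> d) * b"
        by (simp add: comb_def inner_diff_left)
      then have "(b - a \<bullet> x) * (a' \<bullet> d) \<le> (b' - a' \<bullet> x) * (a \<bullet> d)"
        by (simp add: algebra_simps)
      then have "(b - a \<bullet> x) / (a \<bullet> d) * (a' \<bullet> d) \<le> b' - a' \<bullet> x"
        using d(1) by (simp add: pos_divide_le_eq)
      then show ?thesis
        using d(2) by (simp add: g_def neg_divide_le_eq)
    qed
    then have "\<exists>t. (\<forall>l\<in>g ` N. l \<le> t) \<and> (\<forall>u\<in>g ` P. t \<le> u)"
      using fin by (intro finite_separation) auto
    then obtain t where t: "\<And>n. n \<in> N \<Longrightarrow> g n \<le> t" "\<And>p. p \<in> P \<Longrightarrow> t \<le> g p"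
      by blast
    have "a \<bullet> (x + t *\<^sub>R d) \<le> b" if ab: "(a,b) \<in> F" for a b
    proof -
      consider "(a,b) \<in> Z" | "(a,b) \<in> P" | "(a,b) \<in> N"
        using ab FZ by auto
      then show ?thesis
      proof cases
        case 1
        then have "a \<bullet> x \<le> b" "a \<bullet> d = 0"
          using bspec[OF r, of "(a,b)"] by (auto simp: Z_def)
        then show ?thesis
          by (simp add: inner_add_right)
      next
        case 2
        then have "t \<le> (b - a \<bullet> x) / (a \<bullet> d)" "a \<bullet> d > 0"
          using t(2)[of "(a,b)"] by (auto simp: P_def g_def)
        then show ?thesis
          by (simp add: inner_add_right pos_le_divide_eq)
      next
        case 3
        then have "(b - a \<bullet> x) / (a \<bullet> d) \<le> t" "a \<bullet> d < 0"
          using t(1)[of "(a,b)"] by (auto simp: N_def g_def)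
        then show ?thesis
          by (simp add: inner_add_right neg_divide_le_eq)
      qed
    qed
    then show ?l
      by (auto simp: F(2))
  qed
  then have "{x. \<exists>t. x + t *\<^sub>R d \<in> S} = {x. \<forall>(a,b)\<in>Z \<union> comb ` (P \<times> N). a \<bullet> x \<le> b}"
    by (rule Collect_cong)
  then show ?thesis
    unfolding polyhedron_iff_inequalities using fin
    by (intro exI[of _ "Z \<union> comb ` (P \<times> N)"]) simp
qed

text \<open>Since \<open>V = - V\<close>, the set is the sum of \<open>S\<close> and
  \<open>V\<close>. A finite basis of \<open>V\<close> reduces it to shadows along one direction at
  a time.\<close>

lemma polyhedron_plus_subspace:
  fixes S V :: "'a::euclidean_space set"
  assumes "polyhedron S" "subspace V"
  shows "polyhedron {x. \<exists>v\<in>V. x + v \<in> S}"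
proof -
  have span: "polyhedron {x. \<exists>v\<in>span D. x + v \<in> S}" if "finite D" for D
    using that
  proof (induction D)
    case empty
    then show ?case
      using assms by simp
  next
    case (insert d D)
    have "{x. \<exists>v\<in>span (insert d D). x + v \<in> S} = {x. \<exists>t. x + t *\<^sub>R d \<in> {x. \<exists>v\<in>span D. x + v \<in> S}}"
      (is "?l = ?r")
    proof (intro equalityI subsetI)
      fix x assume "x \<in> ?l"
      then obtain v t where v: "x + v \<in> S" "v - t *\<^sub>R d \<in> span D"
        by (auto simp: span_insert)
      then show "x \<in> ?r"
        by (auto intro!: exI[of _ t] bexI[of _ "v - t *\<^sub>R d"])
    next
      fix x assume "x \<in> ?r"
      then obtain v t where v: "x + t *\<^sub>R d + v \<in> S" "v \<in> span D"
        by auto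
      moreover have "t *\<^sub>R d + v \<in> span (insert d D)"
        using v(2) by (auto simp: span_insert intro!: exI[of _ t])
      ultimately show "x \<in> ?l"
        by (auto simp: add.assoc)
    qed
    then show ?case
      using polyhedron_shadow[OF insert.IH, of d] by simp
  qed
  obtain D where "D \<subseteq> V" "independent D" "V \<subseteq> span D"
    using maximal_independent_subset by blast
  then have "span D = V" "finite D"
    using assms(2) span_minimal independent_imp_finite by blast+
  then show ?thesis
    using span by blast
qed

text \<open>The image is a projection of the graph of \<open>h\<close> over \<open>S\<close>. Adding
  the subspace \<open>UNIV \<times> {0}\<close> frees the first component, and the slice at first
  component \<open>0\<close> then reads off the image.\<close>

lemma polyhedron_linear_image:
  fixes S :: "'a::euclidean_space set" and h :: "'a \<Rightarrow> 'b::euclidean_space"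
  assumes S: "polyhedron S" and h: "linear h"
  shows "polyhedron (h ` S)"
proof -
  define G where "G = {p::'a \<times> 'b. fst p \<in> S} \<inter> {p. h (fst p) - snd p \<in> {0}}"
  have "linear (\<lambda>p::'a \<times> 'b. h (fst p) - snd p)"
    using h by (simp add: linear_iff algebra_simps)
  then have "polyhedron {p::'a \<times> 'b. h (fst p) - snd p \<in> {0}}"
    by (rule polyhedron_linear_vimage[rotated]) (simp add: affine_imp_polyhedron)
  then have "polyhedron G"
    unfolding G_def using polyhedron_linear_vimage[OF S linear_fst] by (intro polyhedron_Int)
  moreover have "subspace (UNIV \<times> {0} :: ('a \<times> 'b) set)"
    by (intro subspace_Times subspace_UNIV subspace_single_0)
  ultimately have "polyhedron {p. \<exists>v\<in>UNIV \<times> {0}. p + v \<in> G}"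
    by (rule polyhedron_plus_subspace)
  then have "polyhedron {y::'b. (0,y) \<in> {p. \<exists>v\<in>UNIV \<times> {0}. p + v \<in> G}}"
    by (rule polyhedron_linear_vimage) (simp add: linear_iff)
  also have "{y::'b. (0,y) \<in> {p. \<exists>v\<in>UNIV \<times> {0}. p + v \<in> G}} = h ` S"
    by (auto simp: G_def)
  finally show ?thesis .
qed

section \<open>Finite unions of polyhedra\<close>

lemma finite_union_of_vimage:
  assumes "(finite union_of P) S" "\<And>X. P X \<Longrightarrow> Q (f -` X)"
  shows "(finite union_of Q) (f -` S)"
proof -
  obtain \<U> where \<U>: "finite \<U>" "\<U> \<subseteq> Collect P" "\<Union>\<U> = S"
    using assms(1) by (auto simp: union_of_def)
  have "f -` S = \<Union> ((\<lambda>X. f -` X) ` \<U>)"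
    using \<U>(3) by auto
  then show ?thesis
    using \<U> assms(2) by (auto simp: union_of_def intro!: exI[of _ "(\<lambda>X. f -` X) ` \<U>"])
qed

lemma finite_union_of_image:
  assumes "(finite union_of P) S" "\<And>X. P X \<Longrightarrow> Q (f ` X)"
  shows "(finite union_of Q) (f ` S)"
proof -
  obtain \<U> where \<U>: "finite \<U>" "\<U> \<subseteq> Collect P" "\<Union>\<U> = S"
    using assms(1) by (auto simp: union_of_def)
  have "f ` S = \<Union> ((\<lambda>X. f ` X) ` \<U>)"
    using \<U>(3) by auto
  then show ?thesis
    using \<U> assms(2) by (auto simp: union_of_def intro!: exI[of _ "(\<lambda>X. f ` X) ` \<U>"])
qed

lemma finite_union_of_Int:
  assumes "\<And>S T. P S \<Longrightarrow> P T \<Longrightarrow> P (S \<inter> T)"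
    and "(finite union_of P) S" "(finite union_of P) T"
  shows "(finite union_of P) (S \<inter> T)"
proof -
  have "\<forall>S T. P S \<and> P T \<longrightarrow> (finite union_of P) (S \<inter> T)"
    using assms(1) by (simp add: finite_union_of_inc)
  then show ?thesis
    using assms(2,3) unfolding finite_union_of_Int_eq[symmetric] by simp
qed

text \<open>The shape of the pieces left by complements of polyhedra. Listing weak and strict
  inequalities separately lets the closure be obtained by relaxing the strict ones.\<close>

definition half_open_polyhedron :: "'a::euclidean_space set \<Rightarrow> bool" where
  "half_open_polyhedron S \<longleftrightarrow>
    (\<exists>F G. finite F \<and> finite G \<and> S = {x. (\<forall>(a,b)\<in>F. a \<bullet> x \<le> b) \<and> (\<forall>(a,b)\<in>G. a \<bullet> x < b)})"

lemma half_open_polyhedron_Int: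
  assumes "half_open_polyhedron S" "half_open_polyhedron T"
  shows "half_open_polyhedron (S \<inter> T)"
proof -
  obtain F G F' G' where fin: "finite F" "finite G" "finite F'" "finite G'"
    and S: "S = {x. (\<forall>(a,b)\<in>F. a \<bullet> x \<le> b) \<and> (\<forall>(a,b)\<in>G. a \<bullet> x < b)}"
    and T: "T = {x. (\<forall>(a,b)\<in>F'. a \<bullet> x \<le> b) \<and> (\<forall>(a,b)\<in>G'. a \<bullet> x < b)}"
    using assms by (auto simp: half_open_polyhedron_def)
  have "S \<inter> T = {x. (\<forall>(a,b)\<in>F \<union> F'. a \<bullet> x \<le> b) \<and> (\<forall>(a,b)\<in>G \<union> G'. a \<bullet> x < b)}"
    unfolding S T ball_Un by auto
  then show ?thesis
    unfolding half_open_polyhedron_def using fin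
    by (intro exI[of _ "F \<union> F'"] exI[of _ "G \<union> G'"]) simp
qed

lemma polyhedron_imp_half_open:
  assumes "polyhedron S"
  shows "half_open_polyhedron S"
proof -
  obtain F where "finite F" "S = {x. \<forall>(a,b)\<in>F. a \<bullet> x \<le> b}"
    using assms polyhedron_iff_inequalities by blast
  then show ?thesis
    unfolding half_open_polyhedron_def by (intro exI[of _ F] exI[of _ "{}"]) simp
qed

lemma finite_union_half_open_Compl:
  fixes S :: "'a::euclidean_space set"
  assumes "polyhedron S"
  shows "(finite union_of half_open_polyhedron) (- S)"
proof -
  obtain F where F: "finite F" "S = {x. \<forall>(a,b)\<in>F. a \<bullet> x \<le> b}"
    using assms polyhedron_iff_inequalities by blast
  have "half_open_polyhedron {x. (- a) \<bullet> x < - b}" for a :: 'a and b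
    unfolding half_open_polyhedron_def
    by (rule exI[of _ "{}"], rule exI[of _ "{(- a, - b)}"]) auto
  then have "(finite union_of half_open_polyhedron) (\<Union> ((\<lambda>(a,b). {x. (- a) \<bullet> x < - b}) ` F))"
    using F(1) by (intro finite_union_of_Union) (auto intro: finite_union_of_inc)
  also have "\<Union> ((\<lambda>(a,b). {x. (- a) \<bullet> x < - b}) ` F) = - S"
    by (auto simp: F(2) not_le split_beta intro!: bexI)
  finally show ?thesis .
qed

text \<open>If \<open>y \<in> S\<close> and \<open>x\<close> satisfies all inequalities weakly, then
  the segment from \<open>x\<close> to \<open>y\<close> lies in \<open>S\<close> except possibly at
  \<open>x\<close>, so \<open>x\<close> is a limit of points of \<open>S\<close>. The empty set is
  treated apart because relaxing contradictory strict inequalities can produce points.\<close>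

lemma polyhedron_closure_half_open:
  assumes "half_open_polyhedron S"
  shows "polyhedron (closure S)"
proof (cases "S = {}")
  case False
  then obtain y where y: "y \<in> S"
    by blast
  obtain F G where fin: "finite F" "finite G"
    and S: "S = {x. (\<forall>(a,b)\<in>F. a \<bullet> x \<le> b) \<and> (\<forall>(a,b)\<in>G. a \<bullet> x < b)}"
    using assms by (auto simp: half_open_polyhedron_def)
  define P where "P = {x. \<forall>(a,b)\<in>F \<union> G. a \<bullet> x \<le> b}"
  have P: "polyhedron P"
    unfolding polyhedron_iff_inequalities P_def using fin by (intro exI[of _ "F \<union> G"]) simp
  have "x \<in> closure S" if x: "x \<in> P" for x
  proof -
    define t where "t = (\<lambda>n. 1 / (real n + 1))"
    have t: "0 < t n" "t n \<le> 1" for n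
      by (auto simp: t_def field_simps)
    have "a \<bullet> (x + t n *\<^sub>R (y - x)) \<le> b" if "(a,b) \<in> F" for a b n
    proof -
      have "(1 - t n) * (a \<bullet> x) + t n * (a \<bullet> y) \<le> (1 - t n) * b + t n * b"
        using x y that t[of n] by (intro add_mono mult_left_mono) (auto simp: P_def S)
      then show ?thesis
        by (simp add: algebra_simps)
    qed
    moreover have "a \<bullet> (x + t n *\<^sub>R (y - x)) < b" if "(a,b) \<in> G" for a b n
    proof -
      have "(1 - t n) * (a \<bullet> x) + t n * (a \<bullet> y) < (1 - t n) * b + t n * b"
        using x y that t[of n]
        by (intro add_le_less_mono mult_left_mono mult_strict_left_mono) (auto simp: P_def S)
      then show ?thesis
        by (simp add: algebra_simps)
    qed
    ultimately have "x + t n *\<^sub>R (y - x) \<in> S" for n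
      by (auto simp: S)
    moreover have "(\<lambda>n. x + t n *\<^sub>R (y - x)) \<longlonglongrightarrow> x + 0 *\<^sub>R (y - x)"
      unfolding t_def using LIMSEQ_inverse_real_of_nat
      by (intro tendsto_intros) (simp add: inverse_eq_divide add.commute)
    ultimately show ?thesis
      unfolding closure_sequential by (intro exI[of _ "\<lambda>n. x + t n *\<^sub>R (y - x)"]) auto
  qed
  moreover have "S \<subseteq> P"
    by (auto simp: S P_def intro: less_imp_le)
  ultimately have "closure S = P"
    using polyhedron_imp_closed[OF P] by (simp add: closure_minimal subset_antisym subsetI)
  then show ?thesis
    using P by simp
qed simp

text \<open>Closure commutes with finite unions, so the pieces of a closed set may be replaced by
  their closures.\<close>

lemma closed_finite_union_half_open:
  assumes "closed S" "(finite union_of half_open_polyhedron) S"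
  shows "(finite union_of polyhedron) S"
proof -
  obtain \<U> where \<U>: "finite \<U>" "\<U> \<subseteq> Collect half_open_polyhedron" "\<Union>\<U> = S"
    using assms(2) by (auto simp: union_of_def)
  have "S = closure (\<Union>\<U>)"
    using assms(1) \<U>(3) by simp
  also have "\<dots> = \<Union> (closure ` \<U>)"
    using \<U>(1) by (induction \<U>) (auto simp: closure_Un)
  finally have eq: "S = \<Union> (closure ` \<U>)" .
  show ?thesis
    unfolding eq using \<U>(1,2)
    by (intro finite_union_of_Union finite_imageI) (auto intro: finite_union_of_inc polyhedron_closure_half_open)
qed

section \<open>Normal cones of polyhedra\<close>

definition normal_graph :: "'a::real_inner set \<Rightarrow> ('a \<times> 'a) set" where
  "normal_graph C = {(u,w). u \<in> C \<and> (\<forall>x\<in>C. w \<bullet> (x - u) \<le> 0)}"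

text \<open>The cone is replaced by its intersection with a cube, which is a polytope, so that
  finitely many of its vectors decide membership in the polar.\<close>

lemma polyhedron_polar:
  fixes K :: "('a::euclidean_space \<times> real) set"
  assumes "finite K"
  shows "polyhedron {w. \<forall>d. (\<forall>(a,b)\<in>K. a \<bullet> d \<le> 0) \<longrightarrow> w \<bullet> d \<le> 0}"
proof -
  define T where "T = {d. \<forall>(a,b)\<in>K. a \<bullet> d \<le> 0}"
  have "T = {d. \<forall>(a,b)\<in>(\<lambda>(a,b). (a,0::real)) ` K. a \<bullet> d \<le> b}"
    by (auto simp: T_def)
  then have "polyhedron T"
    unfolding polyhedron_iff_inequalities using assms by blast
  then have "polytope (T \<inter> cbox (-One) One)"
    by (intro polyhedron_Int_polytope) (auto simp: polytope_eq_bounded_polyhedron)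
  then obtain E where E: "finite E" "T \<inter> cbox (-One) One = convex hull E"
    unfolding polytope_def by blast
  have "w \<bullet> d \<le> 0" if w: "\<forall>e\<in>E. w \<bullet> e \<le> 0" and d: "d \<in> T" for w d
  proof -
    have "convex hull E \<subseteq> {d. w \<bullet> d \<le> 0}"
      using w by (intro hull_minimal) (auto simp: convex_halfspace_le)
    \<comment> \<open>Division by \<open>norm d + 1\<close>, which is positive even for
      \<open>d = 0\<close>, moves \<open>d\<close> into the cube without leaving the cone.\<close>
    moreover have "(1 / (norm d + 1)) *\<^sub>R d \<in> T \<inter> cbox (-One) One"
    proof -
      have n: "norm d + 1 > 0"
        using norm_ge_zero[of d] by linarith
      have "-1 \<le> (d \<bullet> i) / (norm d + 1) \<and> (d \<bullet> i) / (norm d + 1) \<le> 1" if "i \<in> Basis" for i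
        using Basis_le_norm[OF that, of d] n by (auto simp: divide_simps)
      then have "(1 / (norm d + 1)) *\<^sub>R d \<in> cbox (-One) One"
        by (simp add: mem_box)
      moreover have "a \<bullet> ((1 / (norm d + 1)) *\<^sub>R d) \<le> 0" if "(a,b) \<in> K" for a b
      proof -
        have "a \<bullet> d \<le> 0"
          using d that by (auto simp: T_def)
        then show ?thesis
          using n by (simp add: divide_nonpos_pos)
      qed
      ultimately show ?thesis
        by (auto simp: T_def)
    qed
    ultimately have "w \<bullet> ((1 / (norm d + 1)) *\<^sub>R d) \<le> 0"
      using E(2) by auto
    moreover have "norm d + 1 > 0"
      using norm_ge_zero[of d] by linarith
    ultimately show ?thesis
      by (simp add: divide_simps)
  qed
  moreover have "E \<subseteq> T"
    using E(2) hull_subset[of E convex] by blast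
  ultimately have "{w. \<forall>d\<in>T. w \<bullet> d \<le> 0} = {w. \<forall>e\<in>E. w \<bullet> e \<le> 0}"
    by blast
  also have "\<dots> = {w. \<forall>(a,b)\<in>(\<lambda>e. (e,0)) ` E. a \<bullet> w \<le> b}"
    by (simp add: inner_commute)
  also have "polyhedron \<dots>"
    unfolding polyhedron_iff_inequalities using E(1) by blast
  finally show ?thesis
    unfolding T_def Ball_def mem_Collect_eq .
qed

text \<open>Active constraints do not increase along \<open>d\<close>, inactive ones have slack and
  survive a short step; finitely many constraints admit a common step length. This is the form in
  which polyhedra are used as local cones.\<close>

lemma feasible_direction:
  fixes F :: "('a::real_inner \<times> real) set"
  assumes "finite F" "\<forall>(a,b)\<in>F. a \<bullet> u \<le> b" "\<forall>(a,b)\<in>F. a \<bullet> u = b \<longrightarrow> a \<bullet> d \<le> 0"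
  shows "\<exists>t>0. \<forall>(a,b)\<in>F. a \<bullet> (u + t *\<^sub>R d) \<le> b"
proof -
  have "\<forall>\<^sub>F t in at_right 0. a \<bullet> (u + t *\<^sub>R d) \<le> b" if ab: "(a,b) \<in> F" for a b
  proof (cases "a \<bullet> u = b")
    case True
    then have "a \<bullet> d \<le> 0"
      using assms(3) ab by blast
    then have "a \<bullet> (u + t *\<^sub>R d) \<le> b" if "t > 0" for t
      using that True by (simp add: inner_add_right mult_le_0_iff)
    then show ?thesis
      using eventually_at_right_less by (rule eventually_mono[rotated])
  next
    case False
    then have "a \<bullet> u < b"
      using assms(2) ab by force
    moreover have "((\<lambda>t. a \<bullet> (u + t *\<^sub>R d)) \<longlongrightarrow> a \<bullet> (u + 0 *\<^sub>R d)) (at_right 0)"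
      by (intro tendsto_intros)
    ultimately have "\<forall>\<^sub>F t in at_right 0. a \<bullet> (u + t *\<^sub>R d) < b"
      by (intro order_tendstoD(2)) auto
    then show ?thesis
      by (rule eventually_mono) auto
  qed
  then have "\<forall>\<^sub>F t in at_right 0. \<forall>(a,b)\<in>F. a \<bullet> (u + t *\<^sub>R d) \<le> b"
    using assms(1) by (simp add: eventually_ball_finite_distrib split_beta)
  then have "\<forall>\<^sub>F t::real in at_right 0. t > 0 \<and> (\<forall>(a,b)\<in>F. a \<bullet> (u + t *\<^sub>R d) \<le> b)"
    using eventually_at_right_less[of "0::real"] by (rule eventually_conj[rotated])
  then show ?thesis
    using eventually_happens'[OF trivial_limit_at_right_real[of 0]] by blast
qed

text \<open>The normal cone at \<open>u\<close> is the polar of the tangent cone cut out by the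
  active constraints. \<open>face K\<close> only demands that the constraints in \<open>K\<close>
  are active, possibly among others. This keeps it closed and does no harm: a smaller
  \<open>K\<close> has a larger tangent cone and hence a smaller polar.\<close>

lemma finite_union_polyhedron_normal_graph:
  fixes C :: "'a::euclidean_space set"
  assumes "polyhedron C"
  shows "(finite union_of polyhedron) (normal_graph C)"
proof -
  obtain F where F: "finite F" "C = {x. \<forall>(a,b)\<in>F. a \<bullet> x \<le> b}"
    using assms polyhedron_iff_inequalities by blast
  define polar where "polar K = {w. \<forall>d. (\<forall>(a,b)\<in>K. a \<bullet> d \<le> 0) \<longrightarrow> w \<bullet> d \<le> 0}" for K :: "('a \<times> real) set"
  define face where "face K = {u\<in>C. \<forall>(a,b)\<in>K. a \<bullet> u = b}" for K
  have "(u,w) \<in> \<Union> ((\<lambda>K. face K \<times> polar K) ` Pow F)" if "(u,w) \<in> normal_graph C" for u w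
  proof -
    have u: "\<forall>(a,b)\<in>F. a \<bullet> u \<le> b" and w: "\<And>x. x \<in> C \<Longrightarrow> w \<bullet> (x - u) \<le> 0"
      using that by (auto simp: normal_graph_def F(2))
    define K where "K = {(a,b)\<in>F. a \<bullet> u = b}"
    have "w \<bullet> d \<le> 0" if "\<forall>(a,b)\<in>K. a \<bullet> d \<le> 0" for d
    proof -
      have "\<exists>t>0. \<forall>(a,b)\<in>F. a \<bullet> (u + t *\<^sub>R d) \<le> b"
        using that by (intro feasible_direction F(1) u) (auto simp: K_def)
      then obtain t where "t > 0" "u + t *\<^sub>R d \<in> C"
        by (auto simp: F(2))
      then show ?thesis
        using w[of "u + t *\<^sub>R d"] by (simp add: mult_le_0_iff)
    qed
    then have "(u,w) \<in> face K \<times> polar K"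
      using u by (auto simp: polar_def face_def K_def F(2))
    then show ?thesis
      by (auto simp: K_def)
  qed
  moreover have "(u,w) \<in> normal_graph C" if "K \<subseteq> F" "u \<in> face K" "w \<in> polar K" for u w K
  proof -
    have "w \<bullet> (x - u) \<le> 0" if "x \<in> C" for x
    proof -
      have "\<forall>(a,b)\<in>K. a \<bullet> (x - u) \<le> 0"
        using \<open>x \<in> C\<close> \<open>K \<subseteq> F\<close> \<open>u \<in> face K\<close> by (fastforce simp: F(2) face_def inner_diff_right)
      then show ?thesis
        using \<open>w \<in> polar K\<close> by (simp add: polar_def)
    qed
    then show ?thesis
      using \<open>u \<in> face K\<close> by (simp add: normal_graph_def face_def)
  qed
  ultimately have eq: "normal_graph C = \<Union> ((\<lambda>K. face K \<times> polar K) ` Pow F)"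
    by auto
  have "polyhedron (face K \<times> polar K)" if "K \<subseteq> F" for K
  proof (rule polyhedron_Times)
    have K: "finite K"
      using that F(1) finite_subset by blast
    have "face K = C \<inter> \<Inter> ((\<lambda>(a,b). {u. a \<bullet> u = b}) ` K)"
      by (auto simp: face_def)
    also have "polyhedron \<dots>"
      using assms K by (auto intro!: polyhedron_Int polyhedron_Inter polyhedron_hyperplane)
    finally show "polyhedron (face K)" .
    show "polyhedron (polar K)"
      unfolding polar_def using K by (rule polyhedron_polar)
  qed
  then show ?thesis
    unfolding eq using F(1) by (intro finite_union_of_Union) (auto intro: finite_union_of_inc)
qed

section \<open>Subdifferentials of piecewise linear-quadratic functions\<close>

lemma proper_fun_edom:
  assumes "proper_fun f" "x \<in> edom f"
  shows "f x = ereal (real_of_ereal (f x))"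
  using assms by (cases "f x") (auto simp: proper_fun_def edom_def)

lemma subdifferential_iff:
  assumes "proper_fun f"
  shows "s \<in> subdifferential f u \<longleftrightarrow>
    u \<in> edom f \<and> (\<forall>y\<in>edom f. real_of_ereal (f u) + s \<bullet> (y - u) \<le> real_of_ereal (f y))"
proof (cases "u \<in> edom f")
  case True
  obtain r where u: "f u = ereal r"
    using proper_fun_edom[OF assms True] by blast
  have "f u + ereal (s \<bullet> (y - u)) \<le> f y \<longleftrightarrow>
      (y \<in> edom f \<longrightarrow> real_of_ereal (f u) + s \<bullet> (y - u) \<le> real_of_ereal (f y))" for y
  proof (cases "y \<in> edom f")
    case y: True
    obtain r' where "f y = ereal r'"
      using proper_fun_edom[OF assms y] by blast
    then show ?thesis
      using u y by simp
  qed (simp add: edom_def)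
  moreover have "\<bar>f u\<bar> \<noteq> \<infinity>"
    using u by simp
  ultimately show ?thesis
    using True by (auto simp: subdifferential_def)
qed (auto simp: subdifferential_def edom_def)

lemma convex_efun_segment:
  assumes f: "convex_efun f" "proper_fun f" and x: "x \<in> edom f" and y: "y \<in> edom f"
    and t: "0 \<le> t" "t \<le> 1"
  shows "x + t *\<^sub>R (y - x) \<in> edom f"
    and "real_of_ereal (f (x + t *\<^sub>R (y - x)))
      \<le> (1 - t) * real_of_ereal (f x) + t * real_of_ereal (f y)"
proof -
  let ?E = "{(x, r::real). f x \<le> ereal r}"
  let ?r = "(1 - t) * real_of_ereal (f x) + t * real_of_ereal (f y)"
  have "(x, real_of_ereal (f x)) \<in> ?E" "(y, real_of_ereal (f y)) \<in> ?E"
    using proper_fun_edom[OF f(2) x] proper_fun_edom[OF f(2) y] by auto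
  moreover have "convex ?E"
    using f(1) by (simp add: convex_efun_def)
  ultimately have "(1 - t) *\<^sub>R (x, real_of_ereal (f x)) + t *\<^sub>R (y, real_of_ereal (f y)) \<in> ?E"
    using t by (intro convexD) auto
  moreover have "(1 - t) *\<^sub>R (x, real_of_ereal (f x)) + t *\<^sub>R (y, real_of_ereal (f y))
      = (x + t *\<^sub>R (y - x), ?r)"
    by (simp add: algebra_simps)
  ultimately have le: "f (x + t *\<^sub>R (y - x)) \<le> ereal ?r"
    by simp
  then show dom: "x + t *\<^sub>R (y - x) \<in> edom f"
    by (auto simp: edom_def)
  from le show "real_of_ereal (f (x + t *\<^sub>R (y - x))) \<le> ?r"
    by (subst (asm) proper_fun_edom[OF f(2) dom]) simp
qed

text \<open>Solved for \<open>f u\<close>, each subgradient inequality is an upper bound that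
  depends continuously on \<open>(u, s)\<close>. Lower semicontinuity carries this bound over to the
  limit, where it also shows that \<open>f u\<close> is finite.\<close>

lemma closed_subdifferential_graph:
  fixes f :: "'a::euclidean_space \<Rightarrow> ereal"
  assumes f: "proper_fun f" "lsc f"
  shows "closed {(u,s). s \<in> subdifferential f u}"
  unfolding closed_sequential_limits
proof (intro allI impI, elim conjE)
  fix p :: "nat \<Rightarrow> 'a \<times> 'a" and l
  assume p: "\<forall>n. p n \<in> {(u,s). s \<in> subdifferential f u}" and lim: "p \<longlonglongrightarrow> l"
  define u s where "u = fst l" and "s = snd l"
  have lims: "(\<lambda>n. fst (p n)) \<longlonglongrightarrow> u" "(\<lambda>n. snd (p n)) \<longlonglongrightarrow> s"
    unfolding u_def s_def using lim by (auto intro: tendsto_fst tendsto_snd)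
  have *: "f u \<le> ereal (real_of_ereal (f y) - s \<bullet> (y - u))" if y: "y \<in> edom f" for y
  proof (rule ccontr)
    assume "\<not> ?thesis"
    then have "ereal (real_of_ereal (f y) - s \<bullet> (y - u)) < f u"
      by simp
    then obtain c where "ereal (real_of_ereal (f y) - s \<bullet> (y - u)) < ereal c" and c: "ereal c < f u"
      using ereal_dense2 by blast
    then have c': "real_of_ereal (f y) - s \<bullet> (y - u) < c"
      by simp
    have "ereal c < Liminf (at u) f"
      using f(2) c by (auto simp: lsc_def intro: less_le_trans)
    then have "\<forall>\<^sub>F z in at u. ereal c < f z"
      by (rule less_LiminfD)
    \<comment> \<open>\<open>Liminf (at u)\<close> disregards the value at \<open>u\<close> itself,
      which is supplied by \<open>ereal c < f u\<close>.\<close>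
    then have "\<forall>\<^sub>F z in nhds u. ereal c < f z"
      using c by (simp add: eventually_nhds_conv_at)
    then have "\<forall>\<^sub>F n in sequentially. ereal c < f (fst (p n))"
      by (rule eventually_compose_filterlim[OF _ lims(1)])
    then have "\<forall>\<^sub>F n in sequentially. c \<le> real_of_ereal (f y) - snd (p n) \<bullet> (y - fst (p n))"
    proof (rule eventually_mono)
      fix n assume n: "ereal c < f (fst (p n))"
      have "snd (p n) \<in> subdifferential f (fst (p n))"
        using p by (auto simp: split_beta)
      then have "fst (p n) \<in> edom f"
        "real_of_ereal (f (fst (p n))) + snd (p n) \<bullet> (y - fst (p n)) \<le> real_of_ereal (f y)"
        using y by (auto simp: subdifferential_iff[OF f(1)])
      moreover from this have "c < real_of_ereal (f (fst (p n)))"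
        using n by (subst (asm) proper_fun_edom[OF f(1)]) auto
      ultimately show "c \<le> real_of_ereal (f y) - snd (p n) \<bullet> (y - fst (p n))"
        by linarith
    qed
    moreover have "(\<lambda>n. real_of_ereal (f y) - snd (p n) \<bullet> (y - fst (p n)))
        \<longlonglongrightarrow> real_of_ereal (f y) - s \<bullet> (y - u)"
      by (intro tendsto_intros lims)
    ultimately have "c \<le> real_of_ereal (f y) - s \<bullet> (y - u)"
      by (intro tendsto_lowerbound[of _ _ sequentially]) auto
    then show False
      using c' by simp
  qed
  obtain y where "y \<in> edom f"
    using f(1) by (auto simp: proper_fun_def)
  from *[OF this] have u: "u \<in> edom f"
    by (auto simp: edom_def)
  have "real_of_ereal (f u) + s \<bullet> (y - u) \<le> real_of_ereal (f y)" if "y \<in> edom f" for y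
    using *[OF that] by (subst (asm) proper_fun_edom[OF f(1) u]) simp
  with u have "s \<in> subdifferential f u"
    by (simp add: subdifferential_iff[OF f(1)])
  then show "l \<in> {(u,s). s \<in> subdifferential f u}"
    by (simp add: u_def s_def split_beta)
qed

section \<open>Convex functions with quadratic pieces\<close>

definition quadratic :: "('a::real_inner \<Rightarrow> 'a) \<Rightarrow> 'a \<Rightarrow> real \<Rightarrow> 'a \<Rightarrow> real" where
  "quadratic Q a \<alpha> x = 1/2 * (x \<bullet> Q x) + a \<bullet> x + \<alpha>"

lemma quadratic_add:
  assumes "linear Q" "\<forall>x y. Q x \<bullet> y = x \<bullet> Q y"
  shows "quadratic Q a \<alpha> (x + t *\<^sub>R d)
    = quadratic Q a \<alpha> x + t * ((Q x + a) \<bullet> d) + t\<^sup>2 / 2 * (d \<bullet> Q d)"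
proof -
  have "Q (x + t *\<^sub>R d) = Q x + t *\<^sub>R Q d"
    using assms(1) by (simp add: linear_add linear_cmul)
  moreover have "x \<bullet> Q d = Q x \<bullet> d" "d \<bullet> Q x = Q x \<bullet> d"
    using assms(2) by (auto simp: inner_commute)
  ultimately show ?thesis
    by (simp add: quadratic_def inner_add_left inner_add_right power2_eq_square field_simps)
qed

text \<open>After division by \<open>t\<close> the right-hand side vanishes as \<open>t\<close>
  tends to \<open>0\<close>. It extracts a first-order condition from an inequality along a
  segment.\<close>

lemma nonpos_if_le_quadratic:
  fixes p r :: real
  assumes "\<And>t. 0 < t \<Longrightarrow> t < 1 \<Longrightarrow> t * p \<le> t\<^sup>2 * r"
  shows "p \<le> 0"
proof (rule ccontr)
  assume "\<not> p \<le> 0"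
  \<comment> \<open>Small enough that \<open>t * (\<bar>r\<bar> + 1)\<close> is at most
    \<open>p / 2\<close>, and capped at \<open>1/2\<close> to stay below \<open>1\<close>.\<close>
  define t where "t = min (1/2) (p / (2 * (\<bar>r\<bar> + 1)))"
  have t: "0 < t" "t < 1"
    using \<open>\<not> p \<le> 0\<close> by (auto simp: t_def min_def)
  then have "p \<le> t * r"
    using assms[OF t] by (simp add: power2_eq_square)
  also have "\<dots> \<le> t * (\<bar>r\<bar> + 1)"
    using t by (intro mult_left_mono) auto
  also have "\<dots> \<le> p / (2 * (\<bar>r\<bar> + 1)) * (\<bar>r\<bar> + 1)"
    by (intro mult_right_mono) (auto simp: t_def)
  also have "\<dots> = p / 2"
    by (simp add: field_simps)
  finally show False
    using \<open>\<not> p \<le> 0\<close> by simp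
qed

text \<open>A segment leaving \<open>u\<close> towards another point of the domain stays, for arbitrarily small
  positive parameters, in one of the finitely many closed pieces containing \<open>u\<close>; hence the
  first-order conditions on all these pieces together are sufficient.\<close>

lemma subdifferential_pieces_iff:
  fixes f :: "'a::euclidean_space \<Rightarrow> ereal"
  assumes f: "proper_fun f" "convex_efun f"
    and \<C>: "finite \<C>" "edom f = \<Union>\<C>" "\<And>C. C \<in> \<C> \<Longrightarrow> polyhedron C"
    and Q: "\<And>C. C \<in> \<C> \<Longrightarrow> linear (Q C)" "\<And>C. C \<in> \<C> \<Longrightarrow> \<forall>x y. Q C x \<bullet> y = x \<bullet> Q C y"
    and q: "\<And>C x. C \<in> \<C> \<Longrightarrow> x \<in> C \<Longrightarrow> f x = ereal (quadratic (Q C) (a C) (\<alpha> C) x)"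
  shows "s \<in> subdifferential f u \<longleftrightarrow>
    u \<in> edom f \<and> (\<forall>C\<in>\<C>. u \<in> C \<longrightarrow> (u, s - (Q C u + a C)) \<in> normal_graph C)"
proof (intro iffI conjI ballI impI)
  assume s: "s \<in> subdifferential f u"
  then show "u \<in> edom f"
    by (simp add: subdifferential_iff[OF f(1)])
  fix C assume C: "C \<in> \<C>" "u \<in> C"
  have "(s - (Q C u + a C)) \<bullet> (x - u) \<le> 0" if x: "x \<in> C" for x
  proof (rule nonpos_if_le_quadratic[of _ "(x - u) \<bullet> Q C (x - u) / 2"])
    fix t :: real assume t: "0 < t" "t < 1"
    let ?y = "u + t *\<^sub>R (x - u)"
    have "?y = (1 - t) *\<^sub>R u + t *\<^sub>R x"
      by (simp add: algebra_simps)
    then have y: "?y \<in> C"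
      using convexD[OF polyhedron_imp_convex[OF \<C>(3)[OF C(1)]] C(2) x, of "1 - t" t] t by simp
    moreover from y have "?y \<in> edom f"
      using C(1) \<C>(2) by blast
    then have "real_of_ereal (f u) + s \<bullet> (?y - u) \<le> real_of_ereal (f ?y)"
      using s unfolding subdifferential_iff[OF f(1)] by blast
    ultimately have "quadratic (Q C) (a C) (\<alpha> C) u + t * (s \<bullet> (x - u)) \<le> quadratic (Q C) (a C) (\<alpha> C) ?y"
      using q[OF C] q[OF C(1) y] by simp
    then show "t * ((s - (Q C u + a C)) \<bullet> (x - u)) \<le> t\<^sup>2 * ((x - u) \<bullet> Q C (x - u) / 2)"
      unfolding quadratic_add[OF Q(1)[OF C(1)] Q(2)[OF C(1)]]
      by (simp add: inner_diff_left[of s] right_diff_distrib)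
  qed
  then show "(u, s - (Q C u + a C)) \<in> normal_graph C"
    using C(2) by (simp add: normal_graph_def)
next
  assume *: "u \<in> edom f \<and> (\<forall>C\<in>\<C>. u \<in> C \<longrightarrow> (u, s - (Q C u + a C)) \<in> normal_graph C)"
  then have u: "u \<in> edom f"
    by blast
  have "real_of_ereal (f u) + s \<bullet> (y - u) \<le> real_of_ereal (f y)" if y: "y \<in> edom f" for y
  proof -
    define d where "d = y - u"
    define t where "t = (\<lambda>n. 1 / (real n + 1))"
    have t: "0 < t n" "t n \<le> 1" for n
      by (auto simp: t_def field_simps)
    have "\<forall>n. \<exists>C\<in>\<C>. u + t n *\<^sub>R d \<in> C"
    proof
      fix n
      have "u + t n *\<^sub>R d \<in> edom f"
        unfolding d_def using convex_efun_segment(1)[OF f(2,1) u y] t[of n] by simp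
      then show "\<exists>C\<in>\<C>. u + t n *\<^sub>R d \<in> C"
        using \<C>(2) by blast
    qed
    then have "\<exists>C\<in>\<C>. infinite {n \<in> UNIV. u + t n *\<^sub>R d \<in> C}"
      by (intro pigeonhole_infinite_rel \<C>(1)) auto
    then obtain C where C: "C \<in> \<C>" "infinite {n. u + t n *\<^sub>R d \<in> C}"
      by auto
    obtain r :: "nat \<Rightarrow> nat" where r: "strict_mono r" "\<And>n. u + t (r n) *\<^sub>R d \<in> C"
      using infinite_enumerate[OF C(2)] by auto
    have "t \<longlonglongrightarrow> 0"
      unfolding t_def using LIMSEQ_inverse_real_of_nat by (simp add: inverse_eq_divide add.commute)
    then have "(\<lambda>n. t (r n)) \<longlonglongrightarrow> 0"
      using LIMSEQ_subseq_LIMSEQ[OF _ r(1), of t 0] by (simp add: o_def)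
    then have "(\<lambda>n. u + t (r n) *\<^sub>R d) \<longlonglongrightarrow> u + 0 *\<^sub>R d"
      by (intro tendsto_intros)
    then have uC: "u \<in> C"
      using closed_sequentially[OF polyhedron_imp_closed[OF \<C>(3)[OF C(1)]]] r(2) by fastforce
    define \<tau> where "\<tau> = t (r 0)"
    have \<tau>: "0 < \<tau>" "\<tau> \<le> 1"
      using t by (auto simp: \<tau>_def)
    define x where "x = u + \<tau> *\<^sub>R d"
    have x: "x \<in> C"
      using r(2) by (simp add: x_def \<tau>_def)
    note quad = quadratic_add[OF Q(1)[OF C(1)] Q(2)[OF C(1)]]
    let ?q = "quadratic (Q C) (a C) (\<alpha> C)"
    let ?g = "(Q C u + a C) \<bullet> d" and ?h = "d \<bullet> Q C d"
    have qu: "real_of_ereal (f u) = ?q u" and qx: "real_of_ereal (f x) = ?q x"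
      using q[OF C(1)] uC x by auto
    \<comment> \<open>\<open>Q C\<close> need not be positive semidefinite. Convexity of
      \<open>f\<close> at the midpoint of \<open>u\<close> and \<open>x\<close>, which stays in
      \<open>C\<close>, gives nonnegative curvature in the one direction \<open>d\<close> that
      matters.\<close>
    have m: "u + (\<tau>/2) *\<^sub>R d \<in> C"
    proof -
      have "u + (\<tau>/2) *\<^sub>R d = (1/2) *\<^sub>R u + (1/2) *\<^sub>R x"
        by (simp add: x_def algebra_simps flip: scaleR_add_left)
      then show ?thesis
        using convexD[OF polyhedron_imp_convex[OF \<C>(3)[OF C(1)]] uC x, of "1/2" "1/2"] by simp
    qed
    have "real_of_ereal (f (u + (1/2) *\<^sub>R (x - u)))
        \<le> (1 - 1/2) * real_of_ereal (f u) + 1/2 * real_of_ereal (f x)"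
      using uC x C(1) \<C>(2) by (intro convex_efun_segment[OF f(2,1)]) auto
    then have "?q (u + (\<tau>/2) *\<^sub>R d) \<le> 1/2 * ?q u + 1/2 * ?q x"
      using q[OF C(1) m] by (simp add: qu qx[unfolded x_def] x_def)
    then have "0 \<le> \<tau>\<^sup>2 * ?h"
      unfolding x_def quad by (simp add: power_divide field_simps)
    then have h: "0 \<le> ?h"
      using \<tau> by (simp add: zero_le_mult_iff)
    \<comment> \<open>The normal cone condition and the nonnegative curvature bound
      \<open>f x\<close> from below, convexity between \<open>u\<close> and \<open>y\<close> bounds
      it from above. Division by \<open>\<tau>\<close> leaves the subgradient inequality at
      \<open>y\<close>.\<close>
    have "(s - (Q C u + a C)) \<bullet> (x - u) \<le> 0"
      using * C(1) uC x by (auto simp: normal_graph_def)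
    then have "\<tau> * (s \<bullet> d) \<le> \<tau> * ?g"
      by (simp add: x_def inner_diff_left algebra_simps)
    moreover have "?q x \<le> (1 - \<tau>) * ?q u + \<tau> * real_of_ereal (f y)"
      using convex_efun_segment(2)[OF f(2,1) u y, of \<tau>] \<tau> by (simp add: qu flip: qx) (simp add: x_def d_def)
    ultimately have "\<tau> * (?q u + s \<bullet> d) \<le> \<tau> * real_of_ereal (f y)"
      using mult_nonneg_nonneg[OF zero_le_power2[of \<tau>] h]
      unfolding x_def quad by (simp add: algebra_simps)
    then show ?thesis
      using \<tau>(1) by (simp add: qu d_def)
  qed
  then show "s \<in> subdifferential f u"
    using u by (simp add: subdifferential_iff[OF f(1)])
qed

theorem finite_union_polyhedron_subdifferential_graph:
  fixes f :: "'a::euclidean_space \<Rightarrow> ereal"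
  assumes f: "proper_fun f" "lsc f" "convex_efun f" "piecewise_linear_quadratic f"
  shows "(finite union_of polyhedron) {(u,s). s \<in> subdifferential f u}"
proof -
  let ?G = "{(u,s). s \<in> subdifferential f u}"
  obtain \<C> where \<C>: "finite \<C>" "\<forall>C\<in>\<C>. polyhedron C" "edom f = \<Union>\<C>"
    and quad: "\<forall>C\<in>\<C>. \<exists>Q a \<alpha>. linear Q \<and> (\<forall>x y. Q x \<bullet> y = x \<bullet> Q y) \<and>
      (\<forall>x\<in>C. f x = ereal (quadratic Q a \<alpha> x))"
    using f(4) unfolding piecewise_linear_quadratic_def quadratic_def by blast
  from bchoice[OF quad] obtain Q where "\<forall>C\<in>\<C>. \<exists>a \<alpha>. linear (Q C) \<and>
      (\<forall>x y. Q C x \<bullet> y = x \<bullet> Q C y) \<and> (\<forall>x\<in>C. f x = ereal (quadratic (Q C) a \<alpha> x))"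
    by blast
  from bchoice[OF this] obtain a where "\<forall>C\<in>\<C>. \<exists>\<alpha>. linear (Q C) \<and>
      (\<forall>x y. Q C x \<bullet> y = x \<bullet> Q C y) \<and> (\<forall>x\<in>C. f x = ereal (quadratic (Q C) (a C) \<alpha> x))"
    by blast
  from bchoice[OF this] obtain \<alpha> where Q: "\<forall>C\<in>\<C>. linear (Q C) \<and>
      (\<forall>x y. Q C x \<bullet> y = x \<bullet> Q C y) \<and> (\<forall>x\<in>C. f x = ereal (quadratic (Q C) (a C) (\<alpha> C) x))"
    by blast
  \<comment> \<open>An affine shear subtracts the gradient of the quadratic on \<open>C\<close> and
    so reduces the condition to the normal cone relation.\<close>
  define R where "R C = (\<lambda>(u,s). (u, s - (Q C u + a C))) -` normal_graph C" for C
  have R: "(finite union_of polyhedron) (R C)" if C: "C \<in> \<C>" for C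
    unfolding R_def
  proof (rule finite_union_of_vimage)
    show "(finite union_of polyhedron) (normal_graph C)"
      using C \<C>(2) by (intro finite_union_polyhedron_normal_graph) auto
    fix X :: "('a \<times> 'a) set" assume X: "polyhedron X"
    have "linear (\<lambda>p. (fst p, snd p - Q C (fst p)))"
      using Q C by (auto simp: linear_iff algebra_simps)
    from polyhedron_affine_vimage[OF X this, of "(0, - a C)"]
    show "polyhedron ((\<lambda>(u,s). (u, s - (Q C u + a C))) -` X)"
      by (simp add: vimage_def split_beta algebra_simps)
  qed
  have "?G = {p. fst p \<in> edom f} \<inter> {p. \<forall>C\<in>\<C>. p \<in> - {p. fst p \<in> C} \<union> R C}"
    using subdifferential_pieces_iff[OF f(1,3) \<C>(1,3), of Q a \<alpha>] \<C>(2) Q by (auto simp: R_def)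
  also have "{p. fst p \<in> edom f} = \<Union> ((\<lambda>C. {p. fst p \<in> C}) ` \<C>)"
    using \<C>(3) by auto
  finally have G: "?G = \<Union> ((\<lambda>C. {p. fst p \<in> C}) ` \<C>) \<inter> {p. \<forall>C\<in>\<C>. p \<in> - {p. fst p \<in> C} \<union> R C}" .
  have fst: "polyhedron {p::'a \<times> 'a. fst p \<in> C}" if "C \<in> \<C>" for C
    using that \<C>(2) by (auto intro!: polyhedron_linear_vimage linear_fst)
  have "(finite union_of half_open_polyhedron) {p. \<forall>C\<in>\<D>. p \<in> - {p. fst p \<in> C} \<union> R C}"
    if "finite \<D>" "\<D> \<subseteq> \<C>" for \<D>
    using that
  proof (induction \<D>)
    case empty
    show ?case
      by (simp add: finite_union_of_inc polyhedron_imp_half_open)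
  next
    case (insert C \<D>)
    have "(finite union_of half_open_polyhedron) ((- {p. fst p \<in> C} \<union> R C) \<inter> {p. \<forall>C\<in>\<D>. p \<in> - {p. fst p \<in> C} \<union> R C})"
    proof (rule finite_union_of_Int[where P = half_open_polyhedron, OF half_open_polyhedron_Int])
      show "(finite union_of half_open_polyhedron) (- {p. fst p \<in> C} \<union> R C)"
        using insert.prems fst R polyhedron_imp_half_open
        by (intro finite_union_of_Un finite_union_half_open_Compl) (auto intro: union_of_mono)
      show "(finite union_of half_open_polyhedron) {p. \<forall>C\<in>\<D>. p \<in> - {p. fst p \<in> C} \<union> R C}"
        using insert by simp
    qed
    moreover have "(- {p. fst p \<in> C} \<union> R C) \<inter> {p. \<forall>C\<in>\<D>. p \<in> - {p. fst p \<in> C} \<union> R C}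
        = {p. \<forall>C\<in>insert C \<D>. p \<in> - {p. fst p \<in> C} \<union> R C}"
      by auto
    ultimately show ?case
      by simp
  qed
  moreover have "(finite union_of half_open_polyhedron) (\<Union> ((\<lambda>C. {p::'a \<times> 'a. fst p \<in> C}) ` \<C>))"
    using \<C>(1) fst by (intro finite_union_of_Union) (auto intro: finite_union_of_inc polyhedron_imp_half_open)
  ultimately have "(finite union_of half_open_polyhedron) ?G"
    unfolding G using \<C>(1) by (intro finite_union_of_Int[where P = half_open_polyhedron, OF half_open_polyhedron_Int]) auto
  then show ?thesis
    using closed_subdifferential_graph[OF f(1,2)] by (rule closed_finite_union_half_open[rotated])
qed

section \<open>The Frank-Wolfe theorem\<close>

text \<open>If the minimum is not attained, the minimisers of least norm over
  growing balls escape to infinity in some direction \<open>d\<close>, and subtracting \<open>d\<close> from a far enough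
  one stays in \<open>C\<close> without increasing the function, although it decreases the norm.\<close>

lemma quadratic_attains_min:
  fixes C :: "'a::euclidean_space set"
  assumes C: "polyhedron C" "C \<noteq> {}"
    and Q: "linear Q" "\<forall>x y. Q x \<bullet> y = x \<bullet> Q y"
    and bdd: "\<And>x. x \<in> C \<Longrightarrow> m \<le> quadratic Q a \<alpha> x"
  shows "\<exists>x\<in>C. \<forall>y\<in>C. quadratic Q a \<alpha> x \<le> quadratic Q a \<alpha> y"
proof (rule ccontr)
  assume no_min: "\<not> ?thesis"
  let ?q = "quadratic Q a \<alpha>"
  obtain F where F: "finite F" "C = {x. \<forall>(a,b)\<in>F. a \<bullet> x \<le> b}"
    using C(1) polyhedron_iff_inequalities by blast
  have bl: "bounded_linear Q"
    using Q(1) by (simp add: linear_conv_bounded_linear)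
  have cont: "continuous_on S ?q" for S
    unfolding quadratic_def by (intro continuous_intros linear_continuous_on bl)
  obtain x0 where x0: "x0 \<in> C"
    using C(2) by blast
  \<comment> \<open>The radius is at least \<open>norm x0\<close>, so that no \<open>S n\<close> is
    empty.\<close>
  define S where "S n = C \<inter> cball 0 (norm x0 + real n)" for n
  have S: "compact (S n)" "S n \<noteq> {}" for n
    using polyhedron_imp_closed[OF C(1)] x0 by (auto simp: S_def intro!: closed_Int_compact)
  have "\<exists>x\<in>S n. (\<forall>y\<in>S n. ?q x \<le> ?q y) \<and> (\<forall>y\<in>S n. ?q y \<le> ?q x \<longrightarrow> norm x \<le> norm y)" for n
  proof -
    obtain z where z: "z \<in> S n" "\<forall>y\<in>S n. ?q z \<le> ?q y"
      using continuous_attains_inf[OF S cont] by blast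
    let ?M = "S n \<inter> ?q -` {..?q z}"
    have "closed ?M"
      using S(1) by (intro continuous_closed_preimage cont) (auto intro: compact_imp_closed)
    then have "compact (S n \<inter> ?M)"
      by (rule compact_Int_closed[OF S(1)])
    moreover have "S n \<inter> ?M = ?M"
      by blast
    ultimately have "compact ?M"
      by simp
    moreover have "?M \<noteq> {}"
      using z(1) by auto
    ultimately obtain x where x: "x \<in> ?M" "\<forall>y\<in>?M. norm x \<le> norm y"
      using continuous_attains_inf[of ?M norm] continuous_on_norm[OF continuous_on_id] by blast
    have "?q x = ?q z"
      using x(1) z(2) by force
    then show ?thesis
      using x z by (intro bexI[of _ x]) auto
  qed
  then have "\<forall>n. \<exists>x. x \<in> S n \<and> (\<forall>y\<in>S n. ?q x \<le> ?q y) \<and> (\<forall>y\<in>S n. ?q y \<le> ?q x \<longrightarrow> norm x \<le> norm y)"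
    by blast
  from choice[OF this] obtain x where x: "\<And>n. x n \<in> S n" "\<And>n y. y \<in> S n \<Longrightarrow> ?q (x n) \<le> ?q y"
      "\<And>n y. y \<in> S n \<Longrightarrow> ?q y \<le> ?q (x n) \<Longrightarrow> norm (x n) \<le> norm y"
    by blast
  have xC: "x n \<in> C" for n
    using x(1) by (simp add: S_def)
  \<comment> \<open>If \<open>norm (x n) \<le> R\<close> for arbitrarily large \<open>n\<close>, all
    these points lie in a single \<open>S k\<close>. Then \<open>x k\<close> is as good as each of
    them and hence as good as any point of \<open>C\<close>, contrary to
    \<open>no_min\<close>.\<close>
  have "\<exists>N. \<forall>n\<ge>N. R < norm (x n)" for R
  proof (rule ccontr)
    assume "\<not> ?thesis"
    then have R: "\<And>N. \<exists>n\<ge>N. norm (x n) \<le> R"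
      by (auto simp: not_less)
    obtain k :: nat where k: "R \<le> real k"
      using real_arch_simple by blast
    have "?q (x k) \<le> ?q y" if y: "y \<in> C" for y
    proof -
      obtain j :: nat where j: "norm y \<le> real j"
        using real_arch_simple by blast
      obtain n where n: "j \<le> n" "norm (x n) \<le> R"
        using R by blast
      have "norm y \<le> norm x0 + real n"
        using j n(1) norm_ge_zero[of x0] by (simp add: add_increasing order_trans)
      then have "y \<in> S n"
        using y by (simp add: S_def)
      moreover have "norm (x n) \<le> norm x0 + real k"
        using k n(2) norm_ge_zero[of x0] by linarith
      then have "x n \<in> S k"
        using xC by (simp add: S_def)
      ultimately show ?thesis
        using x(2) order_trans by blast
    qed
    then show False
      using no_min xC by blast
  qed
  then have lim: "filterlim (\<lambda>n. norm (x n)) at_top sequentially"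
    unfolding filterlim_at_top_dense eventually_sequentially by simp
  have "x n /\<^sub>R norm (x n) \<in> cball 0 1" for n
    by (cases "x n = 0") auto
  with compact_cball[of "0::'a" 1] obtain d r where r: "strict_mono r"
    and d: "((\<lambda>n. x n /\<^sub>R norm (x n)) \<circ> r) \<longlonglongrightarrow> d"
    unfolding compact_def by (auto elim!: allE[of _ "\<lambda>n. x n /\<^sub>R norm (x n)"])
  define z \<iota> u where "z n = x (r n)" and "\<iota> n = inverse (norm (z n))" and "u n = \<iota> n *\<^sub>R z n" for n
  have limz: "filterlim (\<lambda>n. norm (z n)) at_top sequentially"
    unfolding z_def using filterlim_compose[OF lim filterlim_subseq[OF r]] .
  then have \<iota>: "\<iota> \<longlonglongrightarrow> 0"
    unfolding \<iota>_def by (rule tendsto_inverse_0_at_top)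
  have u: "u \<longlonglongrightarrow> d"
    using d by (simp add: o_def u_def[abs_def] \<iota>_def z_def)
  have zu: "z n = norm (z n) *\<^sub>R u n" for n
    by (cases "z n = 0") (simp_all add: u_def \<iota>_def)
  have zC: "z n \<in> C" for n
    using xC by (simp add: z_def)
  have \<iota>0: "\<iota> n \<ge> 0" for n
    by (simp add: \<iota>_def)
  have pos: "\<forall>\<^sub>F n in sequentially. norm (z n) > 0"
    using limz unfolding filterlim_at_top_dense by blast
  have "(\<lambda>n. norm (u n)) \<longlonglongrightarrow> norm d"
    using u by (rule tendsto_norm)
  moreover have "(\<lambda>n. norm (u n)) \<longlonglongrightarrow> 1"
    by (rule tendsto_eventually, rule eventually_mono[OF pos]) (simp add: u_def \<iota>_def)
  ultimately have nd: "norm d = 1"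
    by (rule LIMSEQ_unique)
  \<comment> \<open>\<open>d\<close> is a recession direction of \<open>C\<close>: divide the
    constraints at \<open>z n\<close> by \<open>norm (z n)\<close> and pass to the limit.\<close>
  have rec: "a \<bullet> d \<le> 0" if ab: "(a,b) \<in> F" for a b
  proof (rule tendsto_le[OF sequentially_bot])
    show "(\<lambda>n. a \<bullet> u n) \<longlonglongrightarrow> a \<bullet> d"
      by (intro tendsto_intros u)
    show "(\<lambda>n. \<iota> n * b) \<longlonglongrightarrow> 0"
      using tendsto_mult_left_zero[OF \<iota>] .
    have "a \<bullet> z n \<le> b" for n
      using zC[of n] ab by (auto simp: F(2))
    then show "\<forall>\<^sub>F n in sequentially. a \<bullet> u n \<le> \<iota> n * b"
      using \<iota>0 by (intro always_eventually allI) (simp add: u_def mult_left_mono)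
  qed
  \<comment> \<open>Dividing \<open>?q (z n) \<le> ?q (x 0)\<close> by the squared norm of
    \<open>z n\<close> leaves only the quadratic term in the limit.\<close>
  have curv: "d \<bullet> Q d \<le> 0"
  proof -
    have "1/2 * (u n \<bullet> Q (u n)) + \<iota> n * (a \<bullet> u n) + \<iota> n * \<iota> n * \<alpha> \<le> \<iota> n * \<iota> n * ?q (x 0)" for n
    proof -
      have "x 0 \<in> S (r n)"
        using x(1)[of 0] by (auto simp: S_def)
      then have "?q (z n) \<le> ?q (x 0)"
        using x(2) by (simp add: z_def)
      then have "\<iota> n * \<iota> n * ?q (z n) \<le> \<iota> n * \<iota> n * ?q (x 0)"
        using \<iota>0 by (intro mult_left_mono) auto
      then show ?thesis
        by (simp add: u_def quadratic_def linear_cmul[OF Q(1)] algebra_simps)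
    qed
    moreover have "(\<lambda>n. 1/2 * (u n \<bullet> Q (u n)) + \<iota> n * (a \<bullet> u n) + \<iota> n * \<iota> n * \<alpha>)
        \<longlonglongrightarrow> 1/2 * (d \<bullet> Q d) + 0 * (a \<bullet> d) + 0 * 0 * \<alpha>"
      by (intro tendsto_intros u \<iota> bounded_linear.tendsto[OF bl])
    moreover have "(\<lambda>n. \<iota> n * \<iota> n * ?q (x 0)) \<longlonglongrightarrow> 0 * 0 * ?q (x 0)"
      by (intro tendsto_intros \<iota>)
    ultimately have "1/2 * (d \<bullet> Q d) + 0 * (a \<bullet> d) + 0 * 0 * \<alpha> \<le> 0 * 0 * ?q (x 0)"
      by (intro LIMSEQ_le) auto
    then show ?thesis
      by simp
  qed
  \<comment> \<open>The ray from \<open>y\<close> along \<open>d\<close> stays in \<open>C\<close>.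
    With nonpositive curvature, a negative slope at \<open>y\<close> would push the function below
    \<open>m\<close>; the chosen \<open>t\<close> brings it down to \<open>m - 1\<close> or
    lower.\<close>
  have desc: "0 \<le> (Q y + a) \<bullet> d" if y: "y \<in> C" for y
  proof (rule ccontr)
    let ?g = "(Q y + a) \<bullet> d"
    assume neg: "\<not> 0 \<le> ?g"
    define t where "t = (?q y - m + 1) / - ?g"
    have t: "t \<ge> 0"
      unfolding t_def using neg bdd[OF y] by (intro divide_nonneg_nonneg) auto
    have "a \<bullet> (y + t *\<^sub>R d) \<le> b" if "(a,b) \<in> F" for a b
    proof -
      have "a \<bullet> y \<le> b"
        using y that by (auto simp: F(2))
      then show ?thesis
        using mult_nonneg_nonpos[OF t rec[OF that]] by (simp add: inner_add_right)
    qed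
    then have "y + t *\<^sub>R d \<in> C"
      by (auto simp: F(2))
    then have "m \<le> ?q y + t * ?g + t\<^sup>2 / 2 * (d \<bullet> Q d)"
      using bdd[of "y + t *\<^sub>R d"] by (simp add: quadratic_add[OF Q])
    also have "\<dots> \<le> ?q y + t * ?g"
      using curv by (simp add: mult_nonneg_nonpos)
    also have "t * ?g = - (?q y - m + 1)"
      using neg by (simp add: t_def)
    finally show False
      by simp
  qed
  \<comment> \<open>Subtracting \<open>d\<close> does not affect rows with
    \<open>a \<bullet> d = 0\<close>. In the other rows \<open>a \<bullet> d < 0\<close>, so
    \<open>a \<bullet> z n\<close> tends to minus infinity and leaves room for the step.\<close>
  have "\<forall>\<^sub>F n in sequentially. a \<bullet> (z n - d) \<le> b" if ab: "(a,b) \<in> F" for a b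
  proof (cases "a \<bullet> d = 0")
    case True
    have "a \<bullet> z n \<le> b" for n
      using zC[of n] ab by (auto simp: F(2))
    then show ?thesis
      using True by (simp add: inner_diff_right)
  next
    case False
    then have "a \<bullet> d < 0"
      using rec[OF ab] by simp
    moreover have "(\<lambda>n. a \<bullet> u n) \<longlonglongrightarrow> a \<bullet> d"
      by (intro tendsto_intros u)
    ultimately have "filterlim (\<lambda>n. (a \<bullet> u n) * norm (z n)) at_bot sequentially"
      using limz by (intro filterlim_tendsto_neg_mult_at_bot)
    then have "\<forall>\<^sub>F n in sequentially. (a \<bullet> u n) * norm (z n) \<le> b + a \<bullet> d"
      unfolding filterlim_at_bot by blast
    moreover have "a \<bullet> z n = (a \<bullet> u n) * norm (z n)" for n
      by (subst zu) simp
    ultimately show ?thesis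
      by (simp add: inner_diff_right algebra_simps)
  qed
  then have "\<forall>\<^sub>F n in sequentially. \<forall>(a,b)\<in>F. a \<bullet> (z n - d) \<le> b"
    using F(1) by (simp add: eventually_ball_finite_distrib split_beta)
  \<comment> \<open>Since \<open>norm d = 1\<close>, this is the condition for
    \<open>z n - d\<close> to be shorter than \<open>z n\<close>.\<close>
  moreover have "\<forall>\<^sub>F n in sequentially. 1 < 2 * (z n \<bullet> d)"
  proof -
    have "(\<lambda>n. u n \<bullet> d) \<longlonglongrightarrow> d \<bullet> d"
      by (intro tendsto_intros u)
    moreover have "d \<bullet> d = 1"
      using nd by (simp add: dot_square_norm)
    ultimately have "filterlim (\<lambda>n. (u n \<bullet> d) * norm (z n)) at_top sequentially"
      using limz by (intro filterlim_tendsto_pos_mult_at_top[of _ 1]) auto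
    then have "\<forall>\<^sub>F n in sequentially. 1 / 2 < (u n \<bullet> d) * norm (z n)"
      unfolding filterlim_at_top_dense by blast
    moreover have "z n \<bullet> d = (u n \<bullet> d) * norm (z n)" for n
      by (subst zu) simp
    ultimately show ?thesis
      by (auto elim: eventually_mono)
  qed
  ultimately have "\<forall>\<^sub>F n in sequentially. (\<forall>(a,b)\<in>F. a \<bullet> (z n - d) \<le> b) \<and> 1 < 2 * (z n \<bullet> d)"
    by (rule eventually_conj)
  then obtain n where n: "z n - d \<in> C" "1 < 2 * (z n \<bullet> d)"
    using eventually_happens'[OF sequentially_bot] by (auto simp: F(2))
  have "(norm (z n - d))\<^sup>2 = (norm (z n))\<^sup>2 - 2 * (z n \<bullet> d) + (norm d)\<^sup>2"
    by (simp add: power2_norm_eq_inner inner_diff_left inner_diff_right inner_commute)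
  then have "(norm (z n - d))\<^sup>2 < (norm (z n))\<^sup>2"
    using n(2) nd by simp
  then have less: "norm (z n - d) < norm (z n)"
    by (rule power_less_imp_less_base) simp
  moreover have "norm (z n) \<le> norm x0 + real (r n)"
    using x(1)[of "r n"] by (simp add: S_def z_def)
  ultimately have "norm (z n - d) \<le> norm x0 + real (r n)"
    by linarith
  then have "z n - d \<in> S (r n)"
    using n(1) by (simp add: S_def)
  moreover have "?q (z n - d) \<le> ?q (z n)"
    using quadratic_add[OF Q, of a \<alpha> "z n" "-1" d] desc[OF zC[of n]] curv by simp
  ultimately have "norm (z n) \<le> norm (z n - d)"
    using x(3) by (simp add: z_def)
  then show False
    using less by simp
qed

section \<open>The ADMM subproblem and the dual subdifferential\<close>

lemma subdifferential_monotone: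
  assumes "s \<in> subdifferential f x" "t \<in> subdifferential f y"
  shows "0 \<le> (s - t) \<bullet> (x - y)"
proof -
  obtain p q where [simp]: "f x = ereal p" "f y = ereal q"
    using assms by (auto simp: subdifferential_def)
  have "f x + ereal (s \<bullet> (y - x)) \<le> f y" "f y + ereal (t \<bullet> (x - y)) \<le> f x"
    using assms unfolding subdifferential_def by blast+
  then show ?thesis
    by (simp add: inner_diff_left inner_diff_right)
qed

lemma admm_u_step_iff_minimiser:
  assumes J: "proper_fun J"
  shows "u \<in> admm_u_step J A \<eta> b v \<longleftrightarrow> u \<in> edom J \<and>
    (\<forall>y\<in>edom J. real_of_ereal (J u) + (b \<bullet> A u + \<eta>/2 * (norm (A u - v))\<^sup>2)
      \<le> real_of_ereal (J y) + (b \<bullet> A y + \<eta>/2 * (norm (A y - v))\<^sup>2))"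
proof -
  define h where "h y = b \<bullet> A y + \<eta>/2 * (norm (A y - v))\<^sup>2" for y
  have eq: "J y + ereal (b \<bullet> A y) + ereal (\<eta>/2 * (norm (A y - v))\<^sup>2) = J y + ereal (h y)" for y
    by (cases "J y") (auto simp: h_def)
  have fin: "J y + ereal (h y) = ereal (real_of_ereal (J y) + h y)" if "y \<in> edom J" for y
    by (subst proper_fun_edom[OF J that]) simp
  have inf: "J y + ereal (h y) = \<infinity>" if "y \<notin> edom J" for y
    using that by (simp add: edom_def)
  obtain y0 where y0: "y0 \<in> edom J"
    using J by (auto simp: proper_fun_def)
  have "u \<in> admm_u_step J A \<eta> b v \<longleftrightarrow> (\<forall>y. J u + ereal (h u) \<le> J y + ereal (h y))"
    unfolding admm_u_step_def argmin_set_def mem_Collect_eq is_arg_min_linorder eq by simp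
  also have "\<dots> \<longleftrightarrow> u \<in> edom J \<and> (\<forall>y\<in>edom J. real_of_ereal (J u) + h u \<le> real_of_ereal (J y) + h y)"
  proof (cases "u \<in> edom J")
    case True
    have "J u + ereal (h u) \<le> J y + ereal (h y) \<longleftrightarrow>
        (y \<in> edom J \<longrightarrow> real_of_ereal (J u) + h u \<le> real_of_ereal (J y) + h y)" for y
      by (cases "y \<in> edom J") (simp_all add: fin inf True)
    then show ?thesis
      using True by blast
  next
    case False
    have "\<not> J u + ereal (h u) \<le> J y0 + ereal (h y0)"
      by (simp add: fin[OF y0] inf[OF False])
    then show ?thesis
      using False by blast
  qed
  finally show ?thesis
    unfolding h_def .
qed

lemma augmented_term_add:
  assumes "linear A"
  shows "b \<bullet> A (u + t *\<^sub>R d) + \<eta>/2 * (norm (A (u + t *\<^sub>R d) - v))\<^sup>2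
    = b \<bullet> A u + \<eta>/2 * (norm (A u - v))\<^sup>2 + t * ((b + \<eta> *\<^sub>R (A u - v)) \<bullet> A d)
      + t\<^sup>2 * (\<eta>/2 * (norm (A d))\<^sup>2)"
proof -
  have "A (u + t *\<^sub>R d) = A u + t *\<^sub>R A d"
    by (simp add: linear_add[OF assms] linear_cmul[OF assms])
  moreover have "(norm (A u + t *\<^sub>R A d - v))\<^sup>2
      = (norm (A u - v))\<^sup>2 + 2 * t * ((A u - v) \<bullet> A d) + t\<^sup>2 * (norm (A d))\<^sup>2"
    unfolding power2_norm_eq_inner
    by (simp add: inner_add_left inner_add_right inner_diff_left inner_diff_right inner_commute
        power2_eq_square algebra_simps)
  ultimately show ?thesis
    by (simp only: inner_add_left inner_add_right inner_scaleR_left inner_scaleR_right)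
      (simp add: distrib_left)
qed

text \<open>The added term is smooth with gradient
  \<open>adjoint A (b + \<eta> *\<^sub>R (A u - v))\<close>. Minimality along segments yields the
  subgradient inequality, and the converse holds because the second-order remainder is nonnegative
  for \<open>\<eta> \<ge> 0\<close>.\<close>

lemma admm_u_step_iff_subgradient:
  fixes A :: "'u::euclidean_space \<Rightarrow> 'v::euclidean_space"
  assumes J: "proper_fun J" "convex_efun J" and A: "linear A" and \<eta>: "\<eta> \<ge> 0"
  shows "u \<in> admm_u_step J A \<eta> b v \<longleftrightarrow>
    - adjoint A (b + \<eta> *\<^sub>R (A u - v)) \<in> subdifferential J u"
proof -
  define w where "w = b + \<eta> *\<^sub>R (A u - v)"
  define h where "h y = b \<bullet> A y + \<eta>/2 * (norm (A y - v))\<^sup>2" for y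
  have h: "h (u + t *\<^sub>R d) = h u + t * (w \<bullet> A d) + t\<^sup>2 * (\<eta>/2 * (norm (A d))\<^sup>2)" for t d
    unfolding h_def w_def by (rule augmented_term_add[OF A])
  have adj: "- adjoint A w \<bullet> x = - (w \<bullet> A x)" for x
    using adjoint_works[OF A, of x w] by (simp add: inner_commute)
  have "(\<forall>y\<in>edom J. real_of_ereal (J u) + h u \<le> real_of_ereal (J y) + h y) \<longleftrightarrow>
      (\<forall>y\<in>edom J. real_of_ereal (J u) + (- adjoint A w) \<bullet> (y - u) \<le> real_of_ereal (J y))"
    if u: "u \<in> edom J"
  proof (intro iffI ballI)
    fix y assume min: "\<forall>y\<in>edom J. real_of_ereal (J u) + h u \<le> real_of_ereal (J y) + h y"
      and y: "y \<in> edom J"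
    have "real_of_ereal (J u) - w \<bullet> A (y - u) - real_of_ereal (J y) \<le> 0"
    proof (rule nonpos_if_le_quadratic)
      fix t :: real assume t: "0 < t" "t < 1"
      have "real_of_ereal (J u) + h u \<le> real_of_ereal (J (u + t *\<^sub>R (y - u))) + h (u + t *\<^sub>R (y - u))"
        using min convex_efun_segment(1)[OF J(2,1) u y, of t] t by simp
      also have "\<dots> \<le> (1 - t) * real_of_ereal (J u) + t * real_of_ereal (J y)
          + (h u + t * (w \<bullet> A (y - u)) + t\<^sup>2 * (\<eta>/2 * (norm (A (y - u)))\<^sup>2))"
        unfolding h using convex_efun_segment(2)[OF J(2,1) u y, of t] t by simp
      finally show "t * (real_of_ereal (J u) - w \<bullet> A (y - u) - real_of_ereal (J y))
          \<le> t\<^sup>2 * (\<eta>/2 * (norm (A (y - u)))\<^sup>2)"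
        by (simp add: algebra_simps)
    qed
    then show "real_of_ereal (J u) + (- adjoint A w) \<bullet> (y - u) \<le> real_of_ereal (J y)"
      unfolding adj by simp
  next
    fix y assume sub: "\<forall>y\<in>edom J. real_of_ereal (J u) + (- adjoint A w) \<bullet> (y - u) \<le> real_of_ereal (J y)"
      and y: "y \<in> edom J"
    have "real_of_ereal (J u) - w \<bullet> A (y - u) \<le> real_of_ereal (J y)"
      using sub y unfolding adj by fastforce
    moreover have "h y = h u + w \<bullet> A (y - u) + \<eta>/2 * (norm (A (y - u)))\<^sup>2"
      using h[of 1 "y - u"] by simp
    moreover have "0 \<le> \<eta>/2 * (norm (A (y - u)))\<^sup>2"
      using \<eta> by simp
    ultimately show "real_of_ereal (J u) + h u \<le> real_of_ereal (J y) + h y"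
      by linarith
  qed
  then show ?thesis
    unfolding admm_u_step_iff_minimiser[OF J(1)] subdifferential_iff[OF J(1)] h_def[symmetric] w_def[symmetric]
    by blast
qed

text \<open>The affine minorant in \<open>bdd\<close> keeps the objective bounded below. On each
  piece it is a quadratic, so its minimum is attained there by the Frank-Wolfe theorem, and the best
  of the finitely many piecewise minima is global.\<close>

lemma admm_u_step_nonempty:
  fixes A :: "'u::euclidean_space \<Rightarrow> 'v::euclidean_space"
  assumes J: "proper_fun J" "piecewise_linear_quadratic J" and A: "linear A" and \<eta>: "\<eta> > 0"
    and bdd: "\<And>u. u \<in> edom J \<Longrightarrow> - (z \<bullet> A u) - \<gamma> \<le> real_of_ereal (J u)"
  shows "admm_u_step J A \<eta> b v \<noteq> {}"
proof -
  define \<phi> where "\<phi> y = real_of_ereal (J y) + (b \<bullet> A y + \<eta>/2 * (norm (A y - v))\<^sup>2)" for y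
  \<comment> \<open>Insert the minorant for \<open>J\<close> and complete the square in
    \<open>A y - v\<close>; this constant remains.\<close>
  define m where "m = (b - z) \<bullet> v - (norm (b - z))\<^sup>2 / (2 * \<eta>) - \<gamma>"
  have m: "m \<le> \<phi> y" if y: "y \<in> edom J" for y
  proof -
    have "0 \<le> (norm (\<eta> *\<^sub>R (A y - v) + (b - z)))\<^sup>2 / (2 * \<eta>)"
      using \<eta> by simp
    also have "(norm (\<eta> *\<^sub>R (A y - v) + (b - z)))\<^sup>2
        = \<eta>\<^sup>2 * (norm (A y - v))\<^sup>2 + 2 * \<eta> * ((b - z) \<bullet> (A y - v)) + (norm (b - z))\<^sup>2"
      unfolding power2_norm_eq_inner
      by (simp add: inner_add_left inner_add_right inner_commute power2_eq_square algebra_simps)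
    also have "\<dots> / (2 * \<eta>) = \<eta>/2 * (norm (A y - v))\<^sup>2 + (b - z) \<bullet> (A y - v) + (norm (b - z))\<^sup>2 / (2 * \<eta>)"
      using \<eta> by (simp add: field_simps power2_eq_square)
    finally show ?thesis
      using bdd[OF y] by (simp add: m_def \<phi>_def inner_diff_left inner_diff_right)
  qed
  obtain \<C> where \<C>: "finite \<C>" "\<forall>C\<in>\<C>. polyhedron C" "edom J = \<Union>\<C>"
    and quad: "\<forall>C\<in>\<C>. \<exists>Q a \<alpha>. linear Q \<and> (\<forall>x y. Q x \<bullet> y = x \<bullet> Q y) \<and>
      (\<forall>x\<in>C. J x = ereal (quadratic Q a \<alpha> x))"
    using J(2) unfolding piecewise_linear_quadratic_def quadratic_def by blast
  have "\<exists>x\<in>C. \<forall>y\<in>C. \<phi> x \<le> \<phi> y" if C: "C \<in> \<C>" "C \<noteq> {}" for C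
  proof -
    obtain Q a \<alpha> where Q: "linear Q" "\<forall>x y. Q x \<bullet> y = x \<bullet> Q y"
      and q: "\<forall>x\<in>C. J x = ereal (quadratic Q a \<alpha> x)"
      using quad C(1) by blast
    define Q' a' \<alpha>' where "Q' x = Q x + \<eta> *\<^sub>R adjoint A (A x)"
      and "a' = a + adjoint A (b - \<eta> *\<^sub>R v)" and "\<alpha>' = \<alpha> + \<eta>/2 * (norm v)\<^sup>2" for x
    note adj = adjoint_works[OF A]
    have adj': "adjoint A y \<bullet> x = y \<bullet> A x" for x y
      using adj[of x y] by (simp add: inner_commute)
    have "linear Q'"
      using linear_add[OF Q(1)] linear_cmul[OF Q(1)] linear_add[OF A] linear_cmul[OF A]
        linear_add[OF adjoint_linear[OF A]] linear_cmul[OF adjoint_linear[OF A]]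
      by (intro linearI) (auto simp: Q'_def algebra_simps)
    moreover have "\<forall>x y. Q' x \<bullet> y = x \<bullet> Q' y"
      using Q(2) by (simp add: Q'_def inner_add_left inner_add_right adj adj')
    moreover have \<phi>: "\<phi> x = quadratic Q' a' \<alpha>' x" if "x \<in> C" for x
      using q that by (simp add: \<phi>_def quadratic_def Q'_def a'_def \<alpha>'_def inner_add_left inner_add_right
          adj adj' power2_norm_eq_inner inner_diff_left inner_diff_right inner_commute field_simps)
    moreover have "m \<le> quadratic Q' a' \<alpha>' x" if "x \<in> C" for x
      using m[of x] that C(1) \<C>(3) by (auto simp flip: \<phi>)
    ultimately have "\<exists>x\<in>C. \<forall>y\<in>C. quadratic Q' a' \<alpha>' x \<le> quadratic Q' a' \<alpha>' y"
      using C \<C>(2) by (intro quadratic_attains_min) auto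
    then show ?thesis
      using \<phi> by auto
  qed
  then obtain x where x: "\<And>C. C \<in> \<C> \<Longrightarrow> C \<noteq> {} \<Longrightarrow> x C \<in> C"
    "\<And>C y. C \<in> \<C> \<Longrightarrow> C \<noteq> {} \<Longrightarrow> y \<in> C \<Longrightarrow> \<phi> (x C) \<le> \<phi> y"
    by metis
  have "\<C> - {{}} \<noteq> {}"
    using J(1) \<C>(3) by (auto simp: proper_fun_def)
  then obtain C where C: "C \<in> \<C> - {{}}" "\<And>D. D \<in> \<C> - {{}} \<Longrightarrow> \<phi> (x C) \<le> \<phi> (x D)"
    using arg_min_if_finite[of "\<C> - {{}}" "\<lambda>C. \<phi> (x C)"] \<C>(1) by (metis finite_Diff not_less)
  have "\<phi> (x C) \<le> \<phi> y" if y: "y \<in> edom J" for y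
  proof -
    obtain D where D: "D \<in> \<C>" "y \<in> D"
      using y \<C>(3) by blast
    have "\<phi> (x C) \<le> \<phi> (x D)"
      using D by (intro C(2)) auto
    also have "\<dots> \<le> \<phi> y"
      using D by (intro x(2)) auto
    finally show ?thesis .
  qed
  moreover have "x C \<in> edom J"
    using C(1) x(1) \<C>(3) by auto
  ultimately have "x C \<in> admm_u_step J A \<eta> b v"
    by (simp add: admm_u_step_iff_minimiser[OF J(1)] \<phi>_def)
  then show ?thesis
    by blast
qed

section \<open>The Fenchel-Young inequality and subgradients of conjugates\<close>

lemma conjugate_ge:
  assumes J: "proper_fun J" and u: "u \<in> edom J"
  shows "ereal (s \<bullet> u - real_of_ereal (J u)) \<le> conjugate J s"
proof -
  have "ereal (s \<bullet> u - real_of_ereal (J u)) = ereal (s \<bullet> u) - J u"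
    by (subst proper_fun_edom[OF J u]) simp
  also have "\<dots> \<le> conjugate J s"
    unfolding conjugate_def by (rule SUP_upper) simp
  finally show ?thesis .
qed

text \<open>The equality case of the Fenchel-Young inequality.\<close>

lemma conjugate_at_subgradient:
  assumes J: "proper_fun J" and s: "s \<in> subdifferential J u"
  shows "conjugate J s = ereal (s \<bullet> u - real_of_ereal (J u))"
proof (rule antisym)
  have u: "u \<in> edom J" and sub: "\<And>y. y \<in> edom J \<Longrightarrow> real_of_ereal (J u) + s \<bullet> (y - u) \<le> real_of_ereal (J y)"
    using s by (auto simp: subdifferential_iff[OF J])
  show "conjugate J s \<le> ereal (s \<bullet> u - real_of_ereal (J u))"
    unfolding conjugate_def
  proof (rule SUP_least)
    fix y
    show "ereal (s \<bullet> y) - J y \<le> ereal (s \<bullet> u - real_of_ereal (J u))"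
    proof (cases "y \<in> edom J")
      case True
      have "s \<bullet> y - real_of_ereal (J y) \<le> s \<bullet> u - real_of_ereal (J u)"
        using sub[OF True] by (simp add: inner_diff_right)
      then show ?thesis
        by (subst proper_fun_edom[OF J True]) simp
    next
      case False
      then have "J y = \<infinity>"
        by (simp add: edom_def)
      then show ?thesis
        by simp
    qed
  qed
  show "ereal (s \<bullet> u - real_of_ereal (J u)) \<le> conjugate J s"
    by (rule conjugate_ge[OF J u])
qed

text \<open>The easy half of the chain rule: Fenchel-Young holds with equality at \<open>z\<close>
  and as an inequality at every other \<open>y\<close>, always with the same
  \<open>u\<close>.\<close>

lemma subdifferential_dual_intro:
  fixes A :: "'u::euclidean_space \<Rightarrow> 'v::euclidean_space"
  assumes J: "proper_fun J" and A: "linear A" and s: "- adjoint A z \<in> subdifferential J u"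
  shows "- A u \<in> subdifferential (\<lambda>y. conjugate J (- adjoint A y)) z"
proof -
  note conj = conjugate_at_subgradient[OF J s]
  have u: "u \<in> edom J"
    using s by (simp add: subdifferential_iff[OF J])
  have "conjugate J (- adjoint A z) + ereal (- A u \<bullet> (y - z)) \<le> conjugate J (- adjoint A y)" for y
  proof -
    have "adjoint A z \<bullet> u = z \<bullet> A u" "adjoint A y \<bullet> u = y \<bullet> A u"
      using adjoint_works[OF A, of u z] adjoint_works[OF A, of u y] by (simp_all add: inner_commute)
    then have "conjugate J (- adjoint A z) + ereal (- A u \<bullet> (y - z)) = ereal (- adjoint A y \<bullet> u - real_of_ereal (J u))"
      by (simp add: conj inner_diff_right inner_commute)
    also have "\<dots> \<le> conjugate J (- adjoint A y)"
      by (rule conjugate_ge[OF J u])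
    finally show ?thesis .
  qed
  then show ?thesis
    by (simp add: subdifferential_def conj)
qed

text \<open>The relation on the right is monotone and, since the ADMM subproblem is solvable, its
  resolvent is defined everywhere. It is therefore not properly contained in the monotone
  relation on the left, so no qualification condition is needed for the chain rule.\<close>

lemma subdifferential_dual_iff:
  fixes A :: "'u::euclidean_space \<Rightarrow> 'v::euclidean_space"
  assumes J: "proper_fun J" "convex_efun J" "piecewise_linear_quadratic J" and A: "linear A"
    and ne: "subdifferential (\<lambda>y. conjugate J (- adjoint A y)) z0 \<noteq> {}"
  shows "w \<in> subdifferential (\<lambda>y. conjugate J (- adjoint A y)) z \<longleftrightarrow>
    (\<exists>u. w = - A u \<and> - adjoint A z \<in> subdifferential J u)"
proof
  let ?B = "subdifferential (\<lambda>y. conjugate J (- adjoint A y))"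
  assume w: "w \<in> ?B z"
  obtain \<gamma> where \<gamma>: "conjugate J (- adjoint A z0) = ereal \<gamma>"
    using ne by (auto simp: subdifferential_def)
  have "- (z0 \<bullet> A u) - \<gamma> \<le> real_of_ereal (J u)" if "u \<in> edom J" for u
    using conjugate_ge[OF J(1) that, of "- adjoint A z0"] adjoint_works[OF A, of u z0]
    by (simp add: \<gamma> inner_commute)
  \<comment> \<open>With penalty \<open>1\<close> and data \<open>(z + w, 0)\<close> the subproblem
    evaluates the resolvent of the right-hand relation at \<open>z + w\<close>: its minimiser
    \<open>u\<close> yields the point \<open>z + w + A u\<close> with value \<open>- A u\<close>.
    Monotonicity against \<open>w\<close> at \<open>z\<close> then forces
    \<open>w + A u = 0\<close>.\<close>
  then have "admm_u_step J A 1 (z + w) 0 \<noteq> {}"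
    by (intro admm_u_step_nonempty J A) auto
  then obtain u where "u \<in> admm_u_step J A 1 (z + w) 0"
    by blast
  then have u: "- adjoint A (z + w + A u) \<in> subdifferential J u"
    using admm_u_step_iff_subgradient[OF J(1,2) A, of 1 u "z + w" 0] by simp
  have "0 \<le> (w - - A u) \<bullet> (z - (z + w + A u))"
    by (rule subdifferential_monotone[OF w subdifferential_dual_intro[OF J(1) A u]])
  moreover have "z - (z + w + A u) = - (w + A u)"
    by simp
  ultimately have "(w + A u) \<bullet> (w + A u) \<le> 0"
    by (metis diff_minus_eq_add inner_minus_right neg_0_le_iff_le)
  then have "w + A u = 0"
    by (metis inner_ge_zero inner_eq_zero_iff order_antisym)
  then show "\<exists>u. w = - A u \<and> - adjoint A z \<in> subdifferential J u"
    using u by (auto simp: add.assoc eq_neg_iff_add_eq_0)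
next
  assume "\<exists>u. w = - A u \<and> - adjoint A z \<in> subdifferential J u"
  then show "w \<in> subdifferential (\<lambda>y. conjugate J (- adjoint A y)) z"
    using subdifferential_dual_intro[OF J(1) A] by blast
qed

text \<open>For \<open>A = uminus\<close> the map \<open>- adjoint A\<close> is the identity, so
  facts about the conjugate itself are instances of those about its composition with
  \<open>- adjoint A\<close>.\<close>

lemma adjoint_uminus: "adjoint (uminus :: 'a \<Rightarrow> 'a::euclidean_space) = uminus"
  by (rule adjoint_unique) simp

lemma subdifferential_conjugate_intro:
  fixes f :: "'a::euclidean_space \<Rightarrow> ereal"
  assumes "proper_fun f" "z \<in> subdifferential f w"
  shows "w \<in> subdifferential (conjugate f) z"
  using subdifferential_dual_intro[of f uminus z w] assms
  by (simp add: adjoint_uminus linear_uminus)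

lemma subdifferential_conjugate_iff:
  fixes f :: "'a::euclidean_space \<Rightarrow> ereal"
  assumes "proper_fun f" "convex_efun f" "piecewise_linear_quadratic f"
    and "subdifferential (conjugate f) z0 \<noteq> {}"
  shows "w \<in> subdifferential (conjugate f) z \<longleftrightarrow> z \<in> subdifferential f w"
  using subdifferential_dual_iff[of f uminus z0 w z] assms
  by (simp add: adjoint_uminus linear_uminus)

section \<open>Error bounds for polyhedral relations\<close>

lemma infinite_large_terms:
  fixes f :: "nat \<Rightarrow> real"
  assumes "\<not> f \<longlonglongrightarrow> 0" "\<And>n. 0 \<le> f n"
  shows "\<exists>\<epsilon>>0. infinite {n. \<epsilon> \<le> f n}"
proof -
  obtain \<epsilon> where \<epsilon>: "\<epsilon> > 0" "\<not> (\<exists>N. \<forall>n\<ge>N. \<bar>f n\<bar> < \<epsilon>)"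
    using assms(1) unfolding LIMSEQ_iff real_norm_def diff_0_right by blast
  have "infinite {n. \<epsilon> \<le> f n}"
    unfolding infinite_nat_iff_unbounded_le
  proof
    fix N
    obtain n where "n \<ge> N" "\<not> \<bar>f n\<bar> < \<epsilon>"
      using \<epsilon>(2) by blast
    then show "\<exists>n\<ge>N. n \<in> {n. \<epsilon> \<le> f n}"
      using assms(2)[of n] by (intro exI[of _ n]) auto
  qed
  then show ?thesis
    using \<epsilon>(1) by blast
qed

text \<open>If the distances stay above some \<open>\<epsilon>\<close>, the normalised residuals of the projections onto the
  limit section converge, along a subsequence with constant active constraints, to a unit vector
  lying both in the tangent cone of those constraints and in its polar.\<close>

lemma polyhedron_section_infdist:
  fixes P :: "('a::euclidean_space \<times> 'b::euclidean_space) set"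
  assumes P: "polyhedron P" and u: "\<And>n. (u n, p n) \<in> P" and p: "p \<longlonglongrightarrow> pb"
  shows "{x. (x, pb) \<in> P} \<noteq> {}" and "(\<lambda>n. infdist (u n) {x. (x, pb) \<in> P}) \<longlonglongrightarrow> 0"
proof -
  let ?S = "{x. (x, pb) \<in> P}"
  \<comment> \<open>The projection of a polyhedron is again a polyhedron and therefore closed, so
    the limit parameter still has a nonempty section.\<close>
  have "closed (snd ` P)"
    using P by (intro polyhedron_imp_closed polyhedron_linear_image linear_snd)
  moreover have "p n \<in> snd ` P" for n
    using u[of n] by force
  ultimately have "pb \<in> snd ` P"
    using p closed_sequentially by blast
  then show ne: "?S \<noteq> {}"
    by auto
  have "linear (\<lambda>x::'a. (x, 0::'b))"
    by (simp add: linear_iff)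
  from polyhedron_affine_vimage[OF P this, of "(0, pb)"] have S: "polyhedron ?S"
    by simp
  note clo = polyhedron_imp_closed[OF S] and conv = polyhedron_imp_convex[OF S]
  obtain F where F: "finite F" "P = {x. \<forall>(a,b)\<in>F. a \<bullet> x \<le> b}"
    using P polyhedron_iff_inequalities by blast
  show "(\<lambda>n. infdist (u n) ?S) \<longlonglongrightarrow> 0"
  proof (rule ccontr)
    assume "\<not> ?thesis"
    then obtain \<epsilon> where \<epsilon>: "\<epsilon> > 0" "infinite {n. \<epsilon> \<le> infdist (u n) ?S}"
      using infinite_large_terms infdist_nonneg by blast
    define w where "w n = closest_point ?S (u n)" for n
    define e where "e n = u n - w n" for n
    have w: "w n \<in> ?S" for n
      unfolding w_def by (rule closest_point_in_set[OF clo ne])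
    have dot: "e n \<bullet> (x - w n) \<le> 0" if "x \<in> ?S" for x n
      unfolding e_def w_def by (rule closest_point_dot[OF conv clo that])
    define K where "K n = {(a,b)\<in>F. a \<bullet> (w n, pb) = b}" for n
    have "K ` {n. \<epsilon> \<le> infdist (u n) ?S} \<subseteq> Pow F"
      by (auto simp: K_def)
    then have "finite (K ` {n. \<epsilon> \<le> infdist (u n) ?S})"
      using F(1) by (meson finite_Pow_iff finite_subset)
    from pigeonhole_infinite[OF \<epsilon>(2) this] obtain n0
      where n0: "infinite {n \<in> {n. \<epsilon> \<le> infdist (u n) ?S}. K n = K n0}"
      by blast
    obtain r1 :: "nat \<Rightarrow> nat" where r1: "strict_mono r1"
      "\<And>n. r1 n \<in> {n \<in> {n. \<epsilon> \<le> infdist (u n) ?S}. K n = K n0}"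
      using infinite_enumerate[OF n0] by blast
    have e1: "\<epsilon> \<le> norm (e (r1 n))" for n
    proof -
      have "\<epsilon> \<le> infdist (u (r1 n)) ?S"
        using r1(2) by blast
      also have "\<dots> \<le> dist (u (r1 n)) (w (r1 n))"
        by (rule infdist_le[OF w])
      finally show ?thesis
        by (simp add: e_def dist_norm)
    qed
    then have e0: "e (r1 n) \<noteq> 0" for n
      using \<epsilon>(1) by (metis norm_zero not_less)
    have "\<forall>n. e (r1 n) /\<^sub>R norm (e (r1 n)) \<in> sphere 0 1"
      using e0 by simp
    then obtain d r2 where d: "d \<in> sphere 0 1" and r2: "strict_mono r2"
      and lim: "((\<lambda>n. e (r1 n) /\<^sub>R norm (e (r1 n))) \<circ> r2) \<longlonglongrightarrow> d"
      using compact_sphere[of "0::'a" 1] unfolding compact_def by meson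
    define r where "r n = r1 (r2 n)" for n
    define \<delta> where "\<delta> n = e (r n) /\<^sub>R norm (e (r n))" for n
    have \<delta>: "\<delta> \<longlonglongrightarrow> d"
      using lim by (simp add: o_def \<delta>_def[abs_def] r_def)
    have e: "\<epsilon> \<le> norm (e (r n))" "K (r n) = K n0" for n
      using e1 r1(2) by (auto simp: r_def)
    have "strict_mono r"
      unfolding r_def using r1(1) r2 by (simp add: strict_mono_def)
    then have pr: "(\<lambda>n. p (r n)) \<longlonglongrightarrow> pb"
      using LIMSEQ_subseq_LIMSEQ[OF p] by (simp add: o_def)
    \<comment> \<open>For a constraint active at the projection, \<open>a \<bullet> e\<close> is at
      most \<open>c \<bullet> (pb - p)\<close>, which tends to \<open>0\<close>. Residuals of norm
      at least \<open>\<epsilon>\<close> may be normalised without losing this.\<close>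
    have tangent: "a \<bullet> d \<le> 0" if ac: "((a,c),b) \<in> K n0" for a c b
    proof (rule tendsto_le[OF sequentially_bot])
      show "(\<lambda>n. a \<bullet> \<delta> n) \<longlonglongrightarrow> a \<bullet> d"
        by (intro tendsto_intros \<delta>)
      have "(\<lambda>n. \<bar>c \<bullet> (pb - p (r n))\<bar> / \<epsilon>) \<longlonglongrightarrow> \<bar>c \<bullet> (pb - pb)\<bar> / \<epsilon>"
        using \<epsilon>(1) by (intro tendsto_intros pr) auto
      then show "(\<lambda>n. \<bar>c \<bullet> (pb - p (r n))\<bar> / \<epsilon>) \<longlonglongrightarrow> 0"
        by simp
      have "a \<bullet> \<delta> n \<le> \<bar>c \<bullet> (pb - p (r n))\<bar> / \<epsilon>" for n
      proof -
        have "((a,c),b) \<in> K (r n)"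
          using ac e(2) by simp
        then have "((a,c),b) \<in> F" "a \<bullet> w (r n) + c \<bullet> pb = b"
          by (auto simp: K_def)
        moreover from this have "a \<bullet> u (r n) + c \<bullet> p (r n) \<le> b"
          using u[of "r n"] by (auto simp: F(2))
        ultimately have "a \<bullet> e (r n) \<le> \<bar>c \<bullet> (pb - p (r n))\<bar>"
          by (simp add: e_def inner_diff_right)
        then have "a \<bullet> e (r n) / norm (e (r n)) \<le> \<bar>c \<bullet> (pb - p (r n))\<bar> / norm (e (r n))"
          by (intro divide_right_mono) auto
        also have "\<dots> \<le> \<bar>c \<bullet> (pb - p (r n))\<bar> / \<epsilon>"
          using \<epsilon>(1) e(1) e0[of "r2 n"] by (intro divide_left_mono mult_pos_pos) (auto simp: r_def)
        finally show ?thesis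
          by (simp add: \<delta>_def divide_inverse mult.commute)
      qed
      then show "\<forall>\<^sub>F n in sequentially. a \<bullet> \<delta> n \<le> \<bar>c \<bullet> (pb - p (r n))\<bar> / \<epsilon>"
        by simp
    qed
    \<comment> \<open>\<open>d\<close> is a feasible direction of the section at the projection
      \<open>w (r n)\<close>, and the residual of a projection makes no acute angle with such a
      direction. In the limit \<open>d \<bullet> d \<le> 0\<close>, although \<open>d\<close> is a
      unit vector.\<close>
    have "\<delta> n \<bullet> d \<le> 0" for n
    proof -
      have "\<exists>t>0. \<forall>(a,b)\<in>F. a \<bullet> ((w (r n), pb) + t *\<^sub>R (d, 0)) \<le> b"
      proof (rule feasible_direction[OF F(1)])
        show "\<forall>(a,b)\<in>F. a \<bullet> (w (r n), pb) \<le> b"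
          using w[of "r n"] by (auto simp: F(2))
        have "(a,c) \<bullet> (d, 0) \<le> 0" if "((a,c),b) \<in> F" "(a,c) \<bullet> (w (r n), pb) = b" for a c b
        proof -
          have "((a,c),b) \<in> K (r n)"
            using that by (simp add: K_def)
          then show ?thesis
            using tangent e(2) by simp
        qed
        then show "\<forall>(a,b)\<in>F. a \<bullet> (w (r n), pb) = b \<longrightarrow> a \<bullet> (d, 0) \<le> 0"
          by auto
      qed
      then obtain t where t: "t > 0" "w (r n) + t *\<^sub>R d \<in> ?S"
        by (auto simp: F(2))
      have "e (r n) \<bullet> d \<le> 0"
        using dot[OF t(2), of "r n"] t(1) by (simp add: mult_le_0_iff)
      then show ?thesis
        by (simp add: \<delta>_def mult_nonneg_nonpos)
    qed
    moreover have "(\<lambda>n. \<delta> n \<bullet> d) \<longlonglongrightarrow> d \<bullet> d"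
      by (intro tendsto_intros \<delta>)
    ultimately have "d \<bullet> d \<le> 0"
      by (intro LIMSEQ_le_const2[of _ "d \<bullet> d" 0]) auto
    then show False
      using d by (simp add: dot_square_norm)
  qed
qed

text \<open>Infinitely many indices fall into one of the finitely many pieces, so the polyhedral
  case applies along a subsequence. The section of that piece is contained in the section of
  \<open>G\<close> and hence is at least as far away.\<close>

lemma finite_union_polyhedron_section_infdist:
  fixes G :: "('a::euclidean_space \<times> 'b::euclidean_space) set"
  assumes G: "(finite union_of polyhedron) G" and u: "\<And>n. (u n, p n) \<in> G" and p: "p \<longlonglongrightarrow> pb"
  shows "{x. (x, pb) \<in> G} \<noteq> {}" and "(\<lambda>n. infdist (u n) {x. (x, pb) \<in> G}) \<longlonglongrightarrow> 0"
proof -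
  obtain \<U> where \<U>: "finite \<U>" "\<U> \<subseteq> Collect polyhedron" "\<Union>\<U> = G"
    using G by (auto simp: union_of_def)
  have piece: "\<exists>P\<in>\<U>. \<exists>r::nat \<Rightarrow> nat. strict_mono r \<and> (\<forall>n. r n \<in> N \<and> (u (r n), p (r n)) \<in> P)"
    if N: "infinite N" for N
  proof -
    have "\<forall>n\<in>N. \<exists>P\<in>\<U>. (u n, p n) \<in> P"
      using u \<U>(3) by blast
    from pigeonhole_infinite_rel[OF N \<U>(1) this]
    obtain P where P: "P \<in> \<U>" "infinite {n\<in>N. (u n, p n) \<in> P}"
      by blast
    then show ?thesis
      using infinite_enumerate[OF P(2)] by (intro bexI[of _ P]) auto
  qed
  have sec: "{x. (x, pb) \<in> P} \<noteq> {} \<and> (\<lambda>n. infdist (u (r n)) {x. (x, pb) \<in> P}) \<longlonglongrightarrow> 0"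
    if "P \<in> \<U>" "strict_mono r" "\<forall>n. r n \<in> N \<and> (u (r n), p (r n)) \<in> P" for P N and r :: "nat \<Rightarrow> nat"
  proof -
    have "(\<lambda>n. p (r n)) \<longlonglongrightarrow> pb"
      using LIMSEQ_subseq_LIMSEQ[OF p that(2)] by (simp add: o_def)
    moreover have "polyhedron P"
      using that(1) \<U>(2) by blast
    ultimately show ?thesis
      using polyhedron_section_infdist[of P "\<lambda>n. u (r n)" "\<lambda>n. p (r n)" pb] that(3) by auto
  qed
  have sub: "{x. (x, pb) \<in> P} \<subseteq> {x. (x, pb) \<in> G}" if "P \<in> \<U>" for P
    using that \<U>(3) by blast
  obtain P and r :: "nat \<Rightarrow> nat" where "P \<in> \<U>" "strict_mono r" "\<forall>n. r n \<in> UNIV \<and> (u (r n), p (r n)) \<in> P"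
    using piece[OF infinite_UNIV_nat] by blast
  from sec[OF this] sub[OF this(1)] show "{x. (x, pb) \<in> G} \<noteq> {}"
    by blast
  show "(\<lambda>n. infdist (u n) {x. (x, pb) \<in> G}) \<longlonglongrightarrow> 0"
  proof (rule ccontr)
    assume "\<not> ?thesis"
    then obtain \<epsilon> where \<epsilon>: "\<epsilon> > 0" "infinite {n. \<epsilon> \<le> infdist (u n) {x. (x, pb) \<in> G}}"
      using infinite_large_terms infdist_nonneg by blast
    from piece[OF \<epsilon>(2)] obtain P and r :: "nat \<Rightarrow> nat" where P: "P \<in> \<U>" "strict_mono r"
      and r: "\<forall>n. r n \<in> {n. \<epsilon> \<le> infdist (u n) {x. (x, pb) \<in> G}} \<and> (u (r n), p (r n)) \<in> P"
      by blast
    from sec[OF P r] have lim: "{x. (x, pb) \<in> P} \<noteq> {}"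
      "(\<lambda>n. infdist (u (r n)) {x. (x, pb) \<in> P}) \<longlonglongrightarrow> 0"
      by blast+
    have "\<epsilon> \<le> infdist (u (r n)) {x. (x, pb) \<in> P}" for n
    proof -
      have "\<epsilon> \<le> infdist (u (r n)) {x. (x, pb) \<in> G}"
        using r by blast
      also have "\<dots> \<le> infdist (u (r n)) {x. (x, pb) \<in> P}"
        by (rule infdist_mono[OF sub[OF P(1)] lim(1)])
      finally show ?thesis .
    qed
    then have "\<epsilon> \<le> 0"
      by (intro LIMSEQ_le_const[OF lim(2)]) auto
    then show False
      using \<epsilon>(1) by simp
  qed
qed

text \<open>Polyhedra are locally cones: a violation of the bound along a sequence would produce a ray of
  fixed points in \<open>W\<close> issuing from \<open>xb\<close>.\<close>

lemma isolated_fixpoint_error_bound: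
  fixes G :: "('a::euclidean_space \<times> 'a) set"
  assumes G: "(finite union_of polyhedron) G" and W: "affine W" "xb \<in> W"
    and isolated: "\<And>x. x \<in> W \<Longrightarrow> (x,x) \<in> G \<Longrightarrow> x = xb"
  shows "\<exists>c>0. \<exists>e>0. \<forall>x t. x \<in> W \<longrightarrow> (x,t) \<in> G \<longrightarrow> dist x xb < e \<longrightarrow> dist x xb \<le> c * dist x t"
proof (rule ccontr)
  assume contr: "\<not> ?thesis"
  obtain \<U> where \<U>: "finite \<U>" "\<U> \<subseteq> Collect polyhedron" "\<Union>\<U> = G"
    using G by (auto simp: union_of_def)
  \<comment> \<open>The violation for the constant \<open>n + 1\<close> and the radius
    \<open>1 / (n + 1)\<close>.\<close>
  have "\<forall>n. \<exists>q. fst q \<in> W \<and> q \<in> G \<and> norm (fst q - xb) < inverse (real (Suc n)) \<and>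
      real (Suc n) * norm (fst q - snd q) < norm (fst q - xb)"
  proof
    fix n
    have "\<not> (\<forall>x t. x \<in> W \<longrightarrow> (x,t) \<in> G \<longrightarrow> dist x xb < inverse (real (Suc n)) \<longrightarrow>
        dist x xb \<le> real (Suc n) * dist x t)"
      using contr by (metis inverse_positive_iff_positive of_nat_0_less_iff zero_less_Suc)
    then obtain x t where "x \<in> W" "(x,t) \<in> G" "dist x xb < inverse (real (Suc n))"
        "\<not> dist x xb \<le> real (Suc n) * dist x t"
      by blast
    then show "\<exists>q. fst q \<in> W \<and> q \<in> G \<and> norm (fst q - xb) < inverse (real (Suc n)) \<and>
        real (Suc n) * norm (fst q - snd q) < norm (fst q - xb)"
      by (intro exI[of _ "(x,t)"]) (simp add: dist_norm)
  qed
  from choice[OF this] obtain q where q: "\<And>n. fst (q n) \<in> W" "\<And>n. q n \<in> G"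
    "\<And>n. norm (fst (q n) - xb) < inverse (real (Suc n))"
    "\<And>n. real (Suc n) * norm (fst (q n) - snd (q n)) < norm (fst (q n) - xb)"
    by blast
  have "\<forall>n\<in>UNIV. \<exists>P\<in>\<U>. q n \<in> P"
    using q(2) \<U>(3) by blast
  from pigeonhole_infinite_rel[OF infinite_UNIV_nat \<U>(1) this]
  obtain P where P: "P \<in> \<U>" "infinite {n\<in>UNIV. q n \<in> P}"
    by blast
  obtain r1 :: "nat \<Rightarrow> nat" where r1: "strict_mono r1" "\<And>n. q (r1 n) \<in> P"
    using infinite_enumerate[OF P(2)] by auto
  define \<nu> where "\<nu> n = norm (fst (q n) - xb)" for n
  have \<nu>: "\<nu> n > 0" for n
    unfolding \<nu>_def by (rule le_less_trans[OF _ q(4)[of n]]) simp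
  have "\<forall>n. (fst (q (r1 n)) - xb) /\<^sub>R \<nu> (r1 n) \<in> sphere 0 1"
    using \<nu> less_imp_neq[OF \<nu>] by (auto simp: \<nu>_def)
  then obtain d r2 where d: "d \<in> sphere 0 1" and r2: "strict_mono r2"
    and lim: "((\<lambda>n. (fst (q (r1 n)) - xb) /\<^sub>R \<nu> (r1 n)) \<circ> r2) \<longlonglongrightarrow> d"
    using compact_sphere[of "0::'a" 1] unfolding compact_def by meson
  define r where "r n = r1 (r2 n)" for n
  have r: "strict_mono r"
    unfolding r_def using r1(1) r2 by (simp add: strict_mono_def)
  define \<delta> where "\<delta> n = (fst (q (r n)) - xb) /\<^sub>R \<nu> (r n)" for n
  have \<delta>: "\<delta> \<longlonglongrightarrow> d"
    using lim by (simp add: o_def \<delta>_def[abs_def] r_def)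
  have small: "norm (fst (q n) - snd (q n)) / \<nu> n \<le> inverse (real (Suc n))" for n
    using q(4)[of n] \<nu>[of n] by (simp add: \<nu>_def field_simps)
  have inv: "(\<lambda>n. inverse (real (Suc (r n)))) \<longlonglongrightarrow> 0"
    using LIMSEQ_subseq_LIMSEQ[OF LIMSEQ_inverse_real_of_nat r] by (simp add: o_def)
  \<comment> \<open>The residual \<open>t - x\<close> relative to the distance of \<open>x\<close>
    from \<open>xb\<close>. As it vanishes in the limit, both components of \<open>q\<close> leave
    \<open>xb\<close> in the same direction \<open>d\<close>.\<close>
  define \<rho> where "\<rho> n = (snd (q (r n)) - fst (q (r n))) /\<^sub>R \<nu> (r n)" for n
  have \<rho>: "\<rho> \<longlonglongrightarrow> 0"
  proof (rule Lim_null_comparison[OF _ inv])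
    have "norm (\<rho> n) \<le> inverse (real (Suc (r n)))" for n
      using small[of "r n"] \<nu>[of "r n"] by (simp add: \<rho>_def norm_minus_commute divide_inverse mult.commute)
    then show "\<forall>\<^sub>F n in sequentially. norm (\<rho> n) \<le> inverse (real (Suc (r n)))"
      by simp
  qed
  have split: "q (r n) = (xb, xb) + \<nu> (r n) *\<^sub>R (\<delta> n, \<delta> n + \<rho> n)" for n
    using less_imp_neq[OF \<nu>[of "r n"]] by (simp add: \<delta>_def \<rho>_def prod_eq_iff flip: scaleR_add_right)
  have \<nu>r: "(\<lambda>n. \<nu> (r n)) \<longlonglongrightarrow> 0"
  proof (rule Lim_null_comparison[OF _ inv])
    show "\<forall>\<^sub>F n in sequentially. norm (\<nu> (r n)) \<le> inverse (real (Suc (r n)))"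
      using q(3) by (intro always_eventually allI less_imp_le) (simp add: \<nu>_def)
  qed
  have lim\<delta>\<rho>: "(\<lambda>n. (\<delta> n, \<delta> n + \<rho> n)) \<longlonglongrightarrow> (d, d)"
    using tendsto_Pair[OF \<delta> tendsto_add[OF \<delta> \<rho>]] by simp
  have "(\<lambda>n. q (r n)) \<longlonglongrightarrow> (xb, xb) + 0 *\<^sub>R (d, d)"
    unfolding split by (intro tendsto_intros \<nu>r lim\<delta>\<rho>)
  moreover have poly: "polyhedron P"
    using P(1) \<U>(2) by blast
  moreover have qP: "q (r n) \<in> P" for n
    using r1(2) by (simp add: r_def)
  ultimately have xbP: "(xb, xb) \<in> P"
    using closed_sequentially[OF polyhedron_imp_closed, of P "\<lambda>n. q (r n)"] by simp
  obtain F where F: "finite F" "P = {x. \<forall>(a,b)\<in>F. a \<bullet> x \<le> b}"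
    using poly polyhedron_iff_inequalities by blast
  have "\<exists>t>0. \<forall>(a,b)\<in>F. a \<bullet> ((xb, xb) + t *\<^sub>R (d, d)) \<le> b"
  proof (rule feasible_direction[OF F(1)])
    show "\<forall>(a,b)\<in>F. a \<bullet> (xb, xb) \<le> b"
      using xbP by (auto simp: F(2))
    have "a \<bullet> (d, d) \<le> 0" if "(a,b) \<in> F" "a \<bullet> (xb, xb) = b" for a b
    proof -
      have "a \<bullet> (\<delta> n, \<delta> n + \<rho> n) \<le> 0" for n
      proof -
        have "a \<bullet> q (r n) \<le> b"
          using qP[of n] that(1) by (auto simp: F(2))
        then have "\<nu> (r n) * (a \<bullet> (\<delta> n, \<delta> n + \<rho> n)) \<le> 0"
          using that(2) unfolding split inner_add_right inner_scaleR_right by linarith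
        then show ?thesis
          using \<nu>[of "r n"] by (simp add: mult_le_0_iff)
      qed
      moreover have "(\<lambda>n. a \<bullet> (\<delta> n, \<delta> n + \<rho> n)) \<longlonglongrightarrow> a \<bullet> (d, d)"
        by (intro tendsto_inner tendsto_const lim\<delta>\<rho>)
      ultimately show ?thesis
        by (intro LIMSEQ_le_const2) auto
    qed
    then show "\<forall>(a,b)\<in>F. a \<bullet> (xb, xb) = b \<longrightarrow> a \<bullet> (d, d) \<le> 0"
      by blast
  qed
  then obtain t where t: "t > 0" "(xb + t *\<^sub>R d, xb + t *\<^sub>R d) \<in> P"
    by (auto simp: F(2))
  \<comment> \<open>The affine set \<open>W\<close> contains the whole line through
    \<open>xb\<close> and a further point of \<open>W\<close>, so the step length \<open>t\<close>
    along \<open>\<delta> n\<close> is allowed; closedness of \<open>W\<close> then admits the limit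
    \<open>d\<close>.\<close>
  have "xb + t *\<^sub>R \<delta> n \<in> W" for n
  proof -
    have "xb + t *\<^sub>R \<delta> n = (1 - t / \<nu> (r n)) *\<^sub>R xb + (t / \<nu> (r n)) *\<^sub>R fst (q (r n))"
      by (simp add: \<delta>_def algebra_simps divide_inverse)
    then show ?thesis
      using W q(1) by (auto intro!: mem_affine)
  qed
  moreover have "(\<lambda>n. xb + t *\<^sub>R \<delta> n) \<longlonglongrightarrow> xb + t *\<^sub>R d"
    by (intro tendsto_intros \<delta>)
  ultimately have "xb + t *\<^sub>R d \<in> W"
    by (rule closed_sequentially[OF polyhedron_imp_closed[OF affine_imp_polyhedron[OF W(1)]]])
  then have "xb + t *\<^sub>R d = xb"
    using t(2) P(1) \<U>(3) by (intro isolated) auto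
  then show False
    using t(1) d by auto
qed

section \<open>The Douglas-Rachford operator\<close>

text \<open>Here \<open>b\<close> is the resolvent of \<open>\<eta> D\<close> at \<open>x\<close>,
  and \<open>z\<close> is that of \<open>\<eta> B\<close> at the reflected point
  \<open>2 b - x = b - \<eta> v\<close>. The average of \<open>2 z - (2 b - x)\<close> and
  \<open>x\<close> is \<open>x + z - b = z + \<eta> v\<close>. In terms of the graph points
  \<open>(b, v)\<close> and \<open>(z, w)\<close> everything is linear.\<close>

lemma mem_DR_map_iff:
  "t \<in> DR_map \<eta> B D x \<longleftrightarrow>
    (\<exists>b v z w. v \<in> D b \<and> w \<in> B z \<and> x = b + \<eta> *\<^sub>R v \<and> z + \<eta> *\<^sub>R w = b - \<eta> *\<^sub>R v \<and> t = z + \<eta> *\<^sub>R v)"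
  (is "?l \<longleftrightarrow> ?r")
proof -
  have res: "z \<in> resolvent (scale_map \<eta> \<Phi>) y \<longleftrightarrow> (\<exists>w\<in>\<Phi> z. y = z + \<eta> *\<^sub>R w)"
    for \<Phi> :: "'a \<Rightarrow> 'a set" and y z
    by (auto simp: resolvent_def inv_map_def scale_map_def set_plus_def)
  have "?l \<longleftrightarrow> (\<exists>b\<in>resolvent (scale_map \<eta> D) x. \<exists>z\<in>resolvent (scale_map \<eta> B) (2 *\<^sub>R b - x).
      t = (1/2) *\<^sub>R ((2 *\<^sub>R z - (2 *\<^sub>R b - x)) + x))"
    unfolding DR_map_def reflected_resolvent_def by blast
  also have "\<dots> \<longleftrightarrow> (\<exists>b. \<exists>v\<in>D b. \<exists>z. \<exists>w\<in>B z. x = b + \<eta> *\<^sub>R v \<and> 2 *\<^sub>R b - x = z + \<eta> *\<^sub>R w \<and>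
      t = (1/2) *\<^sub>R ((2 *\<^sub>R z - (2 *\<^sub>R b - x)) + x))"
    unfolding Bex_def res by blast
  also have "\<dots> \<longleftrightarrow> ?r"
  proof -
    have "2 *\<^sub>R b - x = z + \<eta> *\<^sub>R w \<and> t = (1/2) *\<^sub>R ((2 *\<^sub>R z - (2 *\<^sub>R b - x)) + x) \<longleftrightarrow>
        z + \<eta> *\<^sub>R w = b - \<eta> *\<^sub>R v \<and> t = z + \<eta> *\<^sub>R v"
      if x: "x = b + \<eta> *\<^sub>R v" for b v z w
    proof -
      have "2 *\<^sub>R b - x = b - \<eta> *\<^sub>R v"
        by (simp add: x scaleR_2)
      moreover have "(1/2) *\<^sub>R ((2 *\<^sub>R z - (2 *\<^sub>R b - x)) + x) = z + \<eta> *\<^sub>R v"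
        by (simp add: x scaleR_2[symmetric] algebra_simps)
      ultimately show ?thesis
        by auto
    qed
    then show ?thesis
      by blast
  qed
  finally show ?thesis .
qed

text \<open>Two candidates satisfy \<open>b - z = - \<eta> (v - w)\<close>, whereas monotonicity
  makes the inner product of \<open>v - w\<close> and \<open>b - z\<close> nonnegative; so both
  differences vanish.\<close>

lemma resolvent_subdifferential_eq:
  fixes f :: "'a::euclidean_space \<Rightarrow> ereal"
  assumes \<eta>: "\<eta> > 0" and v: "v \<in> subdifferential f b" and x: "x = b + \<eta> *\<^sub>R v"
  shows "resolvent (scale_map \<eta> (subdifferential f)) x = {b}"
proof -
  have "z = b" if w: "w \<in> subdifferential f z" and eq: "b + \<eta> *\<^sub>R v = z + \<eta> *\<^sub>R w" for z w
  proof -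
    have z: "b - z = - \<eta> *\<^sub>R (v - w)"
      using eq by (simp add: algebra_simps)
    have "0 \<le> (v - w) \<bullet> (b - z)"
      by (rule subdifferential_monotone[OF v w])
    then have "\<eta> * ((v - w) \<bullet> (v - w)) \<le> 0"
      unfolding z by simp
    then have "(v - w) \<bullet> (v - w) \<le> 0"
      using \<eta> by (simp add: mult_le_0_iff)
    then have "v - w = 0"
      by (metis inner_ge_zero inner_eq_zero_iff order_antisym)
    then show ?thesis
      using eq by simp
  qed
  then show ?thesis
    using v by (auto simp: resolvent_def inv_map_def scale_map_def set_plus_def x)
qed

text \<open>With \<open>x = b + \<eta> v\<close> and \<open>t = z + \<eta> v\<close> the last term
  is the squared norm of \<open>x - t\<close>. The gap between the two sides is twice the sum of two
  monotonicity products scaled by \<open>\<eta>\<close>: for \<open>f\<close> between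
  \<open>b\<close> and \<open>bb\<close>, and for \<open>g\<close> between \<open>z\<close> and
  \<open>bb\<close>.\<close>

lemma DR_firmly_nonexpansive:
  fixes f g :: "'a::euclidean_space \<Rightarrow> ereal"
  assumes \<eta>: "\<eta> > 0"
    and v: "v \<in> subdifferential f b" and w: "w \<in> subdifferential g z"
    and vb: "vb \<in> subdifferential f bb" and wb: "- vb \<in> subdifferential g bb"
    and eq: "z + \<eta> *\<^sub>R w = b - \<eta> *\<^sub>R v"
  shows "(norm (z + \<eta> *\<^sub>R v - (bb + \<eta> *\<^sub>R vb)))\<^sup>2
    \<le> (norm (b + \<eta> *\<^sub>R v - (bb + \<eta> *\<^sub>R vb)))\<^sup>2 - (norm (b - z))\<^sup>2"
proof -
  define p q r where "p = b - bb" and "q = v - vb" and "r = z - bb"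
  have m1: "0 \<le> q \<bullet> p"
    unfolding p_def q_def by (rule subdifferential_monotone[OF v vb])
  have "0 \<le> (w - - vb) \<bullet> (z - bb)"
    by (rule subdifferential_monotone[OF w wb])
  then have "0 \<le> \<eta> * ((w + vb) \<bullet> r)"
    using \<eta> by (simp add: r_def)
  also have "\<dots> = (\<eta> *\<^sub>R w + \<eta> *\<^sub>R vb) \<bullet> r"
    by (simp add: inner_add_left distrib_left)
  also have "\<eta> *\<^sub>R w + \<eta> *\<^sub>R vb = p - r - \<eta> *\<^sub>R q"
    using eq by (simp add: p_def q_def r_def algebra_simps)
  finally have m2: "0 \<le> (p - r - \<eta> *\<^sub>R q) \<bullet> r" .
  have "(norm (p + \<eta> *\<^sub>R q))\<^sup>2 - (norm (p - r))\<^sup>2 - (norm (r + \<eta> *\<^sub>R q))\<^sup>2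
      = 2 * ((p - r - \<eta> *\<^sub>R q) \<bullet> r + \<eta> * (q \<bullet> p))"
    unfolding power2_norm_eq_inner
    by (simp add: inner_add_left inner_add_right inner_diff_left inner_diff_right inner_commute algebra_simps)
  also have "0 \<le> \<dots>"
    using m2 mult_nonneg_nonneg[OF less_imp_le[OF \<eta>] m1] by (simp del: inner_diff_left)
  finally have "(norm (r + \<eta> *\<^sub>R q))\<^sup>2 \<le> (norm (p + \<eta> *\<^sub>R q))\<^sup>2 - (norm (p - r))\<^sup>2"
    by simp
  moreover have "r + \<eta> *\<^sub>R q = z + \<eta> *\<^sub>R v - (bb + \<eta> *\<^sub>R vb)"
    "p + \<eta> *\<^sub>R q = b + \<eta> *\<^sub>R v - (bb + \<eta> *\<^sub>R vb)" "p - r = b - z"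
    by (simp_all add: p_def q_def r_def algebra_simps)
  ultimately show ?thesis
    by simp
qed

text \<open>Transfers a rate for \<open>x = b + \<eta> v\<close> to the pair \<open>(b, v)\<close>.
  By monotonicity the cross term in the expanded square is nonnegative, so each part is controlled
  separately.\<close>

lemma resolvent_parts_norm_le:
  fixes f :: "'a::euclidean_space \<Rightarrow> ereal"
  assumes \<eta>: "\<eta> > 0" and v: "v \<in> subdifferential f b" and vb: "vb \<in> subdifferential f bb"
  shows "norm ((b, v) - (bb, vb)) \<le> (1 + 1/\<eta>) * norm (b + \<eta> *\<^sub>R v - (bb + \<eta> *\<^sub>R vb))"
proof -
  define p q where "p = b - bb" and "q = v - vb"
  have m: "0 \<le> \<eta> * (q \<bullet> p)"
    using subdifferential_monotone[OF v vb] \<eta> by (simp add: p_def q_def)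
  have eq: "(norm (p + \<eta> *\<^sub>R q))\<^sup>2 = (norm p)\<^sup>2 + 2 * (\<eta> * (q \<bullet> p)) + (\<eta> * norm q)\<^sup>2"
    unfolding power_mult_distrib power2_norm_eq_inner
    by (simp add: inner_add_left inner_add_right inner_commute power2_eq_square)
  have "(norm p)\<^sup>2 \<le> (norm (p + \<eta> *\<^sub>R q))\<^sup>2" "(\<eta> * norm q)\<^sup>2 \<le> (norm (p + \<eta> *\<^sub>R q))\<^sup>2"
    unfolding eq using m zero_le_power2[of "norm p"] zero_le_power2[of "\<eta> * norm q"] by linarith+
  then have p: "norm p \<le> norm (p + \<eta> *\<^sub>R q)" and "\<eta> * norm q \<le> norm (p + \<eta> *\<^sub>R q)"
    by (auto dest: power2_le_imp_le)
  then have q: "norm q \<le> 1/\<eta> * norm (p + \<eta> *\<^sub>R q)"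
    using \<eta> by (simp add: field_simps)
  have "norm (p, q) \<le> norm p + norm q"
    by (rule norm_Pair_le)
  also have "\<dots> \<le> (1 + 1/\<eta>) * norm (p + \<eta> *\<^sub>R q)"
    using p q by (simp add: distrib_right)
  finally show ?thesis
    by (simp add: p_def q_def algebra_simps)
qed

text \<open>Inserting \<open>bound\<close> into \<open>fne\<close> contracts the squared distance by
  \<open>1 - 1 / c^2\<close>; \<open>c \<ge> 1\<close> keeps this factor nonnegative, so that the
  step can be iterated.\<close>

lemma linear_rate_if_error_bound:
  fixes x :: "nat \<Rightarrow> 'a::real_normed_vector"
  assumes c: "c \<ge> 1"
    and fne: "\<And>k. (norm (x (Suc k) - xb))\<^sup>2 \<le> (norm (x k - xb))\<^sup>2 - (norm (x k - x (Suc k)))\<^sup>2"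
    and bound: "\<And>k. norm (x k - xb) \<le> c * norm (x k - x (Suc k))"
  shows "linear_rate x xb (sqrt (1 - 1 / c\<^sup>2))"
proof -
  define q where "q = 1 - 1 / c\<^sup>2"
  have "1 / c\<^sup>2 \<le> 1"
    using c by (simp add: power2_eq_square divide_simps mult_ge1_I)
  then have q: "q \<ge> 0"
    by (simp add: q_def)
  have step: "(norm (x (Suc k) - xb))\<^sup>2 \<le> q * (norm (x k - xb))\<^sup>2" for k
  proof -
    have "(norm (x k - xb))\<^sup>2 \<le> (c * norm (x k - x (Suc k)))\<^sup>2"
      by (rule power_mono[OF bound]) simp
    then have "(norm (x k - xb))\<^sup>2 / c\<^sup>2 \<le> (norm (x k - x (Suc k)))\<^sup>2"
      using c by (simp add: power_mult_distrib divide_le_eq mult.commute)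
    then show ?thesis
      using fne[of k] by (simp add: q_def left_diff_distrib)
  qed
  have sq: "(norm (x k - xb))\<^sup>2 \<le> q ^ k * (norm (x 0 - xb))\<^sup>2" for k
  proof (induction k)
    case (Suc k)
    have "q * (norm (x k - xb))\<^sup>2 \<le> q * (q ^ k * (norm (x 0 - xb))\<^sup>2)"
      using Suc q by (rule mult_left_mono)
    then show ?case
      using step[of k] by (simp add: mult.assoc)
  qed simp
  have "norm (x k - xb) \<le> norm (x 0 - xb) * sqrt q ^ k" for k
  proof (rule power2_le_imp_le)
    have "(sqrt q ^ k)\<^sup>2 = ((sqrt q)\<^sup>2) ^ k"
      by (simp only: mult.commute flip: power_mult)
    also have "\<dots> = q ^ k"
      using q by simp
    finally show "(norm (x k - xb))\<^sup>2 \<le> (norm (x 0 - xb) * sqrt q ^ k)\<^sup>2"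
      using sq[of k] by (simp add: power_mult_distrib mult.commute)
    show "0 \<le> norm (x 0 - xb) * sqrt q ^ k"
      using q by simp
  qed
  then show ?thesis
    unfolding linear_rate_def q_def by blast
qed

section \<open>Polyhedral structure of the graphs of \<open>T\<close>, \<open>B\<close> and
  \<open>D\<close>\<close>

lemma finite_union_polyhedron_DR_graph:
  fixes B D :: "'a::euclidean_space \<Rightarrow> 'a set"
  assumes B: "(finite union_of polyhedron) {(z,w). w \<in> B z}"
    and D: "(finite union_of polyhedron) {(b,v). v \<in> D b}"
  shows "(finite union_of polyhedron) {(x,t). t \<in> DR_map \<eta> B D x}"
proof -
  define E where "E = {p::('a \<times> 'a) \<times> ('a \<times> 'a).
    fst (snd p) + \<eta> *\<^sub>R snd (snd p) - (fst (fst p) - \<eta> *\<^sub>R snd (fst p)) \<in> {0}}"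
  define GD :: "(('a \<times> 'a) \<times> ('a \<times> 'a)) set" where "GD = fst -` {(b,v). v \<in> D b}"
  define GB :: "(('a \<times> 'a) \<times> ('a \<times> 'a)) set" where "GB = snd -` {(z,w). w \<in> B z}"
  define h where "h p = (fst (fst p) + \<eta> *\<^sub>R snd (fst p), fst (snd p) + \<eta> *\<^sub>R snd (fst p))"
    for p :: "('a \<times> 'a) \<times> ('a \<times> 'a)"
  have eq: "{(x,t). t \<in> DR_map \<eta> B D x} = h ` (GD \<inter> GB \<inter> E)"
  proof (intro equalityI subsetI)
    fix p assume "p \<in> {(x,t). t \<in> DR_map \<eta> B D x}"
    then obtain b v z w where "v \<in> D b" "w \<in> B z" "z + \<eta> *\<^sub>R w = b - \<eta> *\<^sub>R v"
      "p = (b + \<eta> *\<^sub>R v, z + \<eta> *\<^sub>R v)"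
      by (auto simp: mem_DR_map_iff)
    then have "((b,v),(z,w)) \<in> GD \<inter> GB \<inter> E" "p = h ((b,v),(z,w))"
      by (auto simp: GD_def GB_def E_def h_def)
    then show "p \<in> h ` (GD \<inter> GB \<inter> E)"
      by blast
  next
    fix p assume "p \<in> h ` (GD \<inter> GB \<inter> E)"
    then obtain b v z w where "v \<in> D b" "w \<in> B z" "z + \<eta> *\<^sub>R w = b - \<eta> *\<^sub>R v"
      "p = (b + \<eta> *\<^sub>R v, z + \<eta> *\<^sub>R v)"
      by (auto simp: GD_def GB_def E_def h_def)
    then show "p \<in> {(x,t). t \<in> DR_map \<eta> B D x}"
      by (auto simp: mem_DR_map_iff)
  qed
  have "linear (\<lambda>p::('a \<times> 'a) \<times> ('a \<times> 'a).
      fst (snd p) + \<eta> *\<^sub>R snd (snd p) - (fst (fst p) - \<eta> *\<^sub>R snd (fst p)))"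
    by (simp add: linear_iff algebra_simps)
  then have "polyhedron E"
    unfolding E_def by (rule polyhedron_linear_vimage[rotated]) (simp add: affine_imp_polyhedron)
  then have "(finite union_of polyhedron) E"
    by (rule finite_union_of_inc)
  moreover have "(finite union_of polyhedron) GD"
    unfolding GD_def using D
    by (rule finite_union_of_vimage) (simp add: vimage_def polyhedron_linear_vimage linear_fst)
  moreover have "(finite union_of polyhedron) GB"
    unfolding GB_def using B
    by (rule finite_union_of_vimage) (simp add: vimage_def polyhedron_linear_vimage linear_snd)
  ultimately have "(finite union_of polyhedron) (GD \<inter> GB \<inter> E)"
    by (intro finite_union_of_Int[where P = polyhedron, OF polyhedron_Int])
  then have "(finite union_of polyhedron) (h ` (GD \<inter> GB \<inter> E))"
  proof (rule finite_union_of_image)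
    fix X :: "(('a \<times> 'a) \<times> ('a \<times> 'a)) set"
    assume "polyhedron X"
    moreover have "linear h"
      by (simp add: h_def linear_iff algebra_simps)
    ultimately show "polyhedron (h ` X)"
      by (rule polyhedron_linear_image)
  qed
  then show ?thesis
    unfolding eq .
qed

text \<open>By the chain rule the graph collects the pairs \<open>(z, - A u)\<close> with
  \<open>- adjoint A z \<in> subdifferential J u\<close>: a linear image of a linear preimage of the
  graph for \<open>J\<close>.\<close>

lemma finite_union_polyhedron_dual_graph:
  fixes A :: "'u::euclidean_space \<Rightarrow> 'v::euclidean_space"
  assumes J: "proper_fun J" "lsc J" "convex_efun J" "piecewise_linear_quadratic J" and A: "linear A"
    and ne: "subdifferential (\<lambda>y. conjugate J (- adjoint A y)) z0 \<noteq> {}"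
  shows "(finite union_of polyhedron)
    {(z,w). w \<in> subdifferential (\<lambda>y. conjugate J (- adjoint A y)) z}"
proof -
  let ?G = "(\<lambda>p::'v \<times> 'u. (snd p, - adjoint A (fst p))) -` {(u,s). s \<in> subdifferential J u}"
  let ?h = "\<lambda>p::'v \<times> 'u. (fst p, - A (snd p))"
  have l: "linear (\<lambda>p::'v \<times> 'u. (snd p, - adjoint A (fst p)))" "linear ?h"
    using linear_add[OF A] linear_cmul[OF A] linear_add[OF adjoint_linear[OF A]] linear_cmul[OF adjoint_linear[OF A]]
    by (auto intro!: linearI)
  have "(finite union_of polyhedron) ?G"
    by (rule finite_union_of_vimage[OF finite_union_polyhedron_subdifferential_graph[OF J]])
      (simp add: vimage_def polyhedron_linear_vimage[OF _ l(1)])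
  then have "(finite union_of polyhedron) (?h ` ?G)"
    by (rule finite_union_of_image) (rule polyhedron_linear_image[OF _ l(2)])
  also have "?h ` ?G = {(z,w). w \<in> subdifferential (\<lambda>y. conjugate J (- adjoint A y)) z}"
  proof (intro equalityI subsetI)
    fix p assume "p \<in> ?h ` ?G"
    then show "p \<in> {(z,w). w \<in> subdifferential (\<lambda>y. conjugate J (- adjoint A y)) z}"
      using subdifferential_dual_intro[OF J(1) A] by auto
  next
    fix p assume "p \<in> {(z,w). w \<in> subdifferential (\<lambda>y. conjugate J (- adjoint A y)) z}"
    then have "snd p \<in> subdifferential (\<lambda>y. conjugate J (- adjoint A y)) (fst p)"
      by auto
    then obtain u where "snd p = - A u" "- adjoint A (fst p) \<in> subdifferential J u"
      unfolding subdifferential_dual_iff[OF J(1,3,4) A ne] by blast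
    then have "p = ?h (fst p, u)" "(fst p, u) \<in> ?G"
      by (auto simp: prod_eq_iff)
    then show "p \<in> ?h ` ?G"
      by (rule image_eqI)
  qed
  finally show ?thesis .
qed

lemma finite_union_polyhedron_conjugate_graph:
  fixes f :: "'a::euclidean_space \<Rightarrow> ereal"
  assumes "proper_fun f" "lsc f" "convex_efun f" "piecewise_linear_quadratic f"
    and "subdifferential (conjugate f) z0 \<noteq> {}"
  shows "(finite union_of polyhedron) {(b,v). v \<in> subdifferential (conjugate f) b}"
  using finite_union_polyhedron_dual_graph[of f uminus z0] assms
  by (simp add: adjoint_uminus linear_uminus)

section \<open>Linear convergence\<close>

lemma Fermat_sum:
  fixes f g :: "'a::real_inner \<Rightarrow> ereal"
  assumes "v \<in> subdifferential f x" "- v \<in> subdifferential g x"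
  shows "x \<in> argmin_set (\<lambda>y. f y + g y)"
proof -
  obtain p q where [simp]: "f x = ereal p" "g x = ereal q"
    using assms by (auto simp: subdifferential_def)
  have "f x + g x \<le> f y + g y" for y
  proof -
    have "f x + ereal (v \<bullet> (y - x)) \<le> f y" "g x + ereal (- v \<bullet> (y - x)) \<le> g y"
      using assms unfolding subdifferential_def by blast+
    from add_mono[OF this] show ?thesis
      by simp
  qed
  then show ?thesis
    by (simp add: argmin_set_def is_arg_min_linorder)
qed

text \<open>The two inclusions form the KKT system with multiplier \<open>b\<close>:
  \<open>adjoint A b\<close> is a subgradient of the composition of \<open>H\<close> with
  \<open>A\<close> at \<open>u\<close>, and it cancels the one of \<open>J\<close>.\<close>

lemma primal_solution_intro:
  fixes A :: "'u::euclidean_space \<Rightarrow> 'v::euclidean_space"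
  assumes A: "linear A" and u: "- adjoint A b \<in> subdifferential J u"
    and b: "b \<in> subdifferential (\<lambda>v. ereal (H v)) (A u)"
  shows "u \<in> primal_solutions J H A"
proof -
  have "adjoint A b \<in> subdifferential (\<lambda>u. ereal (H (A u))) u"
  proof -
    have "adjoint A b \<bullet> (y - u) = b \<bullet> (A y - A u)" for y
      using adjoint_works[OF A, of "y - u" b] by (simp add: inner_commute linear_diff[OF A])
    then show ?thesis
      using b by (simp add: subdifferential_def)
  qed
  then have "u \<in> argmin_set (\<lambda>u. J u + ereal (H (A u)))"
    by (intro Fermat_sum[OF u]) simp
  then show ?thesis
    by (simp add: primal_solutions_def)
qed

text \<open>Up to a reversed sign of \<open>b\<close>, the v-step is a u-step for \<open>H\<close>
  with the identity in place of \<open>A\<close> and \<open>A u\<close> in place of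
  \<open>v\<close>.\<close>

lemma admm_v_step_subgradient:
  fixes H :: "'v::euclidean_space \<Rightarrow> real"
  assumes H: "proper_fun (\<lambda>v. ereal (H v))" "convex_efun (\<lambda>v. ereal (H v))" and \<eta>: "\<eta> \<ge> 0"
    and v: "v \<in> admm_v_step H A \<eta> b u"
  shows "b + \<eta> *\<^sub>R (A u - v) \<in> subdifferential (\<lambda>v. ereal (H v)) v"
proof -
  have min: "H v - b \<bullet> v + \<eta>/2 * (norm (A u - v))\<^sup>2 \<le> H y - b \<bullet> y + \<eta>/2 * (norm (A u - y))\<^sup>2" for y
    using v unfolding admm_v_step_def argmin_set_def mem_Collect_eq is_arg_min_linorder by blast
  have "v \<in> admm_u_step (\<lambda>v. ereal (H v)) (\<lambda>y. y) \<eta> (- b) (A u)"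
    unfolding admm_u_step_iff_minimiser[OF H(1)]
    using min by (auto simp: edom_def norm_minus_commute algebra_simps)
  moreover have "adjoint (\<lambda>y::'v. y) = (\<lambda>y. y)"
    by (rule adjoint_unique) simp
  moreover have "- (- b + \<eta> *\<^sub>R (v - A u)) = b + \<eta> *\<^sub>R (A u - v)"
    by (simp add: algebra_simps)
  ultimately show ?thesis
    using admm_u_step_iff_subgradient[OF H linear_ident \<eta>, of v "- b" "A u"] by (simp only:)
qed

text \<open>The ADMM is the Douglas-Rachford iteration in the variable \<open>x = b + \<eta> v\<close>.\<close>

lemma admm_step_DR:
  fixes A :: "'u::euclidean_space \<Rightarrow> 'v::euclidean_space"
  assumes J: "proper_fun J" "convex_efun J"
    and H: "proper_fun (\<lambda>v. ereal (H v))" "convex_efun (\<lambda>v. ereal (H v))"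
    and A: "linear A" and \<eta>: "\<eta> > 0"
    and v: "v \<in> subdifferential (conjugate (\<lambda>v. ereal (H v))) b"
    and u': "u' \<in> admm_u_step J A \<eta> b v" and v': "v' \<in> admm_v_step H A \<eta> b u'"
    and b': "b' = b + \<eta> *\<^sub>R (A u' - v')"
  shows "- adjoint A (b' + \<eta> *\<^sub>R (v' - v)) \<in> subdifferential J u'"
    and "v' \<in> subdifferential (conjugate (\<lambda>v. ereal (H v))) b'"
    and "b' + \<eta> *\<^sub>R v' \<in> DR_map \<eta> (subdifferential (\<lambda>y. conjugate J (- adjoint A y)))
      (subdifferential (conjugate (\<lambda>v. ereal (H v)))) (b + \<eta> *\<^sub>R v)"
proof -
  let ?z = "b + \<eta> *\<^sub>R (A u' - v)"
  have z: "- adjoint A ?z \<in> subdifferential J u'"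
    using admm_u_step_iff_subgradient[OF J A less_imp_le[OF \<eta>]] u' by blast
  moreover have "?z = b' + \<eta> *\<^sub>R (v' - v)"
    by (simp add: b' algebra_simps)
  ultimately show "- adjoint A (b' + \<eta> *\<^sub>R (v' - v)) \<in> subdifferential J u'"
    by simp
  have "b' \<in> subdifferential (\<lambda>v. ereal (H v)) v'"
    unfolding b' by (rule admm_v_step_subgradient[OF H less_imp_le[OF \<eta>] v'])
  then show "v' \<in> subdifferential (conjugate (\<lambda>v. ereal (H v))) b'"
    by (rule subdifferential_conjugate_intro[OF H(1)])
  have "- A u' \<in> subdifferential (\<lambda>y. conjugate J (- adjoint A y)) ?z"
    by (rule subdifferential_dual_intro[OF J(1) A z])
  moreover have "?z + \<eta> *\<^sub>R (- A u') = b - \<eta> *\<^sub>R v" "b' + \<eta> *\<^sub>R v' = ?z + \<eta> *\<^sub>R v"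
    by (simp_all add: b' algebra_simps)
  ultimately show "b' + \<eta> *\<^sub>R v' \<in> DR_map \<eta> (subdifferential (\<lambda>y. conjugate J (- adjoint A y)))
      (subdifferential (conjugate (\<lambda>v. ereal (H v)))) (b + \<eta> *\<^sub>R v)"
    unfolding mem_DR_map_iff using v by blast
qed

text \<open>The solution set within \<open>W\<close> is the single point \<open>xb\<close>, so
  subregularity is an error bound by the step length. Points with \<open>T x = {}\<close> satisfy
  both sides, the distance to the empty set being \<open>\<infinity>\<close>.\<close>

lemma metrically_subregular_id_minus_iff:
  fixes T :: "'a::real_normed_vector \<Rightarrow> 'a set"
  assumes fix_T: "Fix T \<inter> W = {xb}"
  shows "metrically_subregular (id_minus T) xb 0 W c N \<longleftrightarrow>
    c > 0 \<and> xb \<in> interior N \<and> (\<forall>x\<in>N \<inter> W. \<forall>t\<in>T x. dist x xb \<le> c * dist x t)"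
proof -
  have zero: "0 \<in> id_minus T x \<longleftrightarrow> x \<in> T x" for x
    by (auto simp: id_minus_def)
  then have inv: "inv_map (id_minus T) 0 \<inter> W = {xb}"
    using fix_T by (simp add: inv_map_def Fix_def)
  have xb: "0 \<in> id_minus T xb"
    using fix_T unfolding zero by (auto simp: Fix_def)
  have "edist_set x {xb} \<le> ereal c * edist_set 0 (id_minus T x) \<longleftrightarrow> (\<forall>t\<in>T x. dist x xb \<le> c * dist x t)"
    if c: "c > 0" for x
  proof
    assume le: "edist_set x {xb} \<le> ereal c * edist_set 0 (id_minus T x)"
    show "\<forall>t\<in>T x. dist x xb \<le> c * dist x t"
    proof
      fix t assume "t \<in> T x"
      then have "edist_set 0 (id_minus T x) \<le> ereal (dist 0 (x - t))"
        unfolding edist_set_def id_minus_def by (intro INF_lower) auto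
      then have "ereal c * edist_set 0 (id_minus T x) \<le> ereal c * ereal (dist 0 (x - t))"
        using c by (intro ereal_mult_left_mono) auto
      with le have "edist_set x {xb} \<le> ereal (c * dist 0 (x - t))"
        by (simp add: order_trans)
      then show "dist x xb \<le> c * dist x t"
        by (simp add: edist_set_def dist_norm norm_minus_commute[of t x])
    qed
  next
    assume le: "\<forall>t\<in>T x. dist x xb \<le> c * dist x t"
    have "ereal (dist x xb / c) \<le> edist_set 0 (id_minus T x)"
      unfolding edist_set_def
    proof (rule INF_greatest)
      fix y assume "y \<in> id_minus T x"
      then obtain t where "t \<in> T x" "y = x - t"
        by (auto simp: id_minus_def)
      then show "ereal (dist x xb / c) \<le> ereal (dist 0 y)"
        using le c by (simp add: dist_norm divide_le_eq mult.commute norm_minus_commute[of t x])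
    qed
    then have "ereal c * ereal (dist x xb / c) \<le> ereal c * edist_set 0 (id_minus T x)"
      using c by (intro ereal_mult_left_mono) auto
    then show "edist_set x {xb} \<le> ereal c * edist_set 0 (id_minus T x)"
      using c by (simp add: edist_set_def)
  qed
  then show ?thesis
    unfolding metrically_subregular_def inv using xb by auto
qed

lemma converges_linearly_tendsto:
  assumes "converges_linearly z zb"
  shows "z \<longlonglongrightarrow> zb"
proof -
  obtain r L where r: "0 \<le> r" "r < 1" and L: "\<And>k. norm (z k - zb) \<le> L * r ^ k"
    using assms by (auto simp: converges_linearly_def linear_rate_def)
  have "(\<lambda>k. L * r ^ k) \<longlonglongrightarrow> L * 0"
    using r by (intro tendsto_intros LIMSEQ_power_zero) auto
  then have "(\<lambda>k. L * r ^ k) \<longlonglongrightarrow> 0"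
    by simp
  then have "(\<lambda>k. z k - zb) \<longlonglongrightarrow> 0"
    by (rule Lim_null_comparison[rotated]) (simp add: L)
  then show ?thesis
    by (simp add: LIM_zero_iff)
qed

text \<open>The primal limit set is a section of a polyhedral relation whose parameters
  \<open>(A u, - A\<^sup>T z)\<close> converge along the iteration.\<close>

lemma primal_iterates_approach:
  fixes A :: "'u::euclidean_space \<Rightarrow> 'v::euclidean_space"
  assumes J: "proper_fun J" "lsc J" "convex_efun J" "piecewise_linear_quadratic J" and A: "linear A"
    and u: "\<And>n. s n \<in> subdifferential J (u n)"
    and lim: "(\<lambda>n. A (u n)) \<longlonglongrightarrow> y" "s \<longlonglongrightarrow> sb"
  shows "{x. A x = y \<and> sb \<in> subdifferential J x} \<noteq> {}"
    and "(\<lambda>n. infdist (u n) {x. A x = y \<and> sb \<in> subdifferential J x}) \<longlonglongrightarrow> 0"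
proof -
  define G where "G = (\<lambda>p::'u \<times> 'v \<times> 'u. (fst p, snd (snd p))) -` {(u,s). s \<in> subdifferential J u}
    \<inter> {p. fst (snd p) - A (fst p) \<in> {0}}"
  have "linear (\<lambda>p::'u \<times> 'v \<times> 'u. (fst p, snd (snd p)))"
    by (simp add: linear_iff)
  then have "(finite union_of polyhedron)
      ((\<lambda>p::'u \<times> 'v \<times> 'u. (fst p, snd (snd p))) -` {(u,s). s \<in> subdifferential J u})"
    by (intro finite_union_of_vimage[OF finite_union_polyhedron_subdifferential_graph[OF J]])
      (simp add: vimage_def polyhedron_linear_vimage)
  moreover have "linear (\<lambda>p::'u \<times> 'v \<times> 'u. fst (snd p) - A (fst p))"
    using linear_add[OF A] linear_cmul[OF A] by (intro linearI) (auto simp: algebra_simps)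
  then have "polyhedron {p::'u \<times> 'v \<times> 'u. fst (snd p) - A (fst p) \<in> {0}}"
    by (rule polyhedron_linear_vimage[rotated]) (simp add: affine_imp_polyhedron)
  ultimately have G: "(finite union_of polyhedron) G"
    unfolding G_def by (intro finite_union_of_Int[where P = polyhedron, OF polyhedron_Int])
      (auto intro: finite_union_of_inc)
  have "(u n, (A (u n), s n)) \<in> G" for n
    using u by (simp add: G_def)
  moreover have "(\<lambda>n. (A (u n), s n)) \<longlonglongrightarrow> (y, sb)"
    by (intro tendsto_Pair lim)
  moreover have "{x. (x, (y, sb)) \<in> G} = {x. A x = y \<and> sb \<in> subdifferential J x}"
    by (auto simp: G_def)
  ultimately show "{x. A x = y \<and> sb \<in> subdifferential J x} \<noteq> {}"
      "(\<lambda>n. infdist (u n) {x. A x = y \<and> sb \<in> subdifferential J x}) \<longlonglongrightarrow> 0"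
    using finite_union_polyhedron_section_infdist[OF G, of u "\<lambda>n. (A (u n), s n)" "(y, sb)"] by auto
qed

theorem theorem2p7:
  fixes J :: "'u::euclidean_space \<Rightarrow> ereal"
    and H :: "'v::euclidean_space \<Rightarrow> real"
    and A :: "'u \<Rightarrow> 'v"
    and \<eta> :: real
    and W :: "'v set"
    and xbar :: 'v
    and B D T :: "'v \<Rightarrow> 'v set"
  defines "B \<equiv> subdifferential (\<lambda>y. conjugate J (- adjoint A y))"
    and "D \<equiv> subdifferential (conjugate (\<lambda>v. ereal (H v)))"
    and "T \<equiv> DR_map \<eta> B D"
  assumes J: "proper_fun J" "lsc J" "convex_efun J" "piecewise_linear_quadratic J"
    and H: "proper_fun (\<lambda>v. ereal (H v))" "lsc (\<lambda>v. ereal (H v))"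
      "convex_efun (\<lambda>v. ereal (H v))" "piecewise_linear_quadratic (\<lambda>v. ereal (H v))"
    and A: "linear A"
    and \<eta>: "\<eta> > 0"
    and sol: "\<exists>x. 0 \<in> B x + D x"
    and W: "affine W" "\<forall>x\<in>W. T x \<subseteq> W"
    and fix_T: "Fix T \<inter> W = {xbar}"
  shows "\<exists>N. xbar \<in> interior N \<and>
    (\<exists>c\<ge>1. metrically_subregular (id_minus T) xbar 0 W c N) \<and>
    (\<exists>bbar vbar. resolvent (scale_map \<eta> D) xbar = {bbar} \<and>
      vbar = (1/\<eta>) *\<^sub>R (xbar - bbar) \<and>
      bbar \<in> dual_solutions J H A \<and>
      (\<forall>x0 v0 b0. v0 \<in> D b0 \<and> x0 = b0 + \<eta> *\<^sub>R v0 \<and> x0 \<in> N \<inter> W \<longrightarrow>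
        resolvent (scale_map \<eta> D) x0 = {b0} \<and>
        (\<forall>x. x 0 = x0 \<and> (\<forall>k. x (Suc k) \<in> T (x k)) \<longrightarrow>
          converges_linearly x xbar \<and>
          (\<forall>c\<ge>1. metrically_subregular (id_minus T) xbar 0 W c N \<longrightarrow>
            (\<exists>r. 0 \<le> r \<and> r \<le> sqrt (1 - 1 / c\<^sup>2) \<and> linear_rate x xbar r))) \<and>
        (\<forall>u v b. v 0 = v0 \<and> b 0 = b0 \<and> admm_sequence J H A \<eta> u v b \<longrightarrow>
          converges_linearly (\<lambda>k. (b k, v k)) (bbar, vbar) \<and>
          primal_solutions J H A \<noteq> {} \<and>
          (\<lambda>k. infdist (u k) (primal_solutions J H A)) \<longlonglongrightarrow> 0 \<and>
          ((\<forall>u1 u2. u1 \<in> admm_u_step J A \<eta> bbar vbar \<and> u2 \<in> admm_u_step J A \<eta> bbar vbar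
              \<longrightarrow> u1 = u2) \<longrightarrow>
            (\<exists>ubar \<in> primal_solutions J H A. u \<longlonglongrightarrow> ubar)))))"
proof -
  from sol obtain xs where "B xs \<noteq> {}" "D xs \<noteq> {}"
    by (auto simp: set_plus_def)
  note ne = this[unfolded B_def D_def]
  have "xbar \<in> W" "xbar \<in> T xbar"
    using fix_T by (auto simp: Fix_def)
  then obtain bb vb z w where vb: "vb \<in> D bb" and w: "w \<in> B z" and xbar: "xbar = bb + \<eta> *\<^sub>R vb"
    and z: "z + \<eta> *\<^sub>R w = bb - \<eta> *\<^sub>R vb" "xbar = z + \<eta> *\<^sub>R vb"
    unfolding T_def mem_DR_map_iff by blast
  \<comment> \<open>Comparing the two expressions for the fixed point gives \<open>z = bb\<close>
    and then \<open>w = - vb\<close>; hence \<open>bb\<close> is a zero of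
    \<open>B + D\<close>.\<close>
  have "z = bb"
    using z(2) xbar by simp
  moreover have "w = - vb"
  proof -
    have "\<eta> *\<^sub>R w = \<eta> *\<^sub>R (- vb)"
      using z(1) \<open>z = bb\<close> by (metis diff_conv_add_uminus add_left_cancel scaleR_minus_right)
    then show ?thesis
      using \<eta> by (metis less_irrefl scaleR_cancel_left)
  qed
  ultimately have wb: "- vb \<in> B bb"
    using w by simp

  have fne: "(norm (t - xbar))\<^sup>2 \<le> (norm (x - xbar))\<^sup>2 - (norm (x - t))\<^sup>2" if t: "t \<in> T x" for x t
  proof -
    obtain b v z w where "v \<in> D b" "w \<in> B z" and x: "x = b + \<eta> *\<^sub>R v"
      and eq: "z + \<eta> *\<^sub>R w = b - \<eta> *\<^sub>R v" and "t = z + \<eta> *\<^sub>R v"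
      using t unfolding T_def mem_DR_map_iff by blast
    then show ?thesis
      using DR_firmly_nonexpansive[OF \<eta> _ _ vb[unfolded D_def] wb[unfolded B_def] eq]
      by (simp add: B_def D_def xbar)
  qed
  have nonexp: "dist t xbar \<le> dist x xbar" if "t \<in> T x" for x t
  proof -
    have "(norm (t - xbar))\<^sup>2 \<le> (norm (x - xbar))\<^sup>2"
      using fne[OF that] zero_le_power2[of "norm (x - t)"] by linarith
    then show ?thesis
      unfolding dist_norm by (rule power2_le_imp_le) simp
  qed

  define G where "G = {(x,t). t \<in> T x}"
  have "(finite union_of polyhedron) G"
    unfolding G_def T_def B_def D_def
    by (intro finite_union_polyhedron_DR_graph finite_union_polyhedron_dual_graph[OF J A ne(1)]
        finite_union_polyhedron_conjugate_graph[OF H ne(2)])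
  moreover have "x = xbar" if "x \<in> W" "(x,x) \<in> G" for x
    using that fix_T by (auto simp: Fix_def G_def)
  ultimately have "\<exists>c>0. \<exists>e>0. \<forall>x t. x \<in> W \<longrightarrow> (x,t) \<in> G \<longrightarrow>
      dist x xbar < e \<longrightarrow> dist x xbar \<le> c * dist x t"
    by (rule isolated_fixpoint_error_bound[OF _ W(1) \<open>xbar \<in> W\<close>])
  then obtain c0 e where c0: "c0 > 0" and e: "e > 0"
    and bound_G: "\<forall>x t. x \<in> W \<longrightarrow> (x,t) \<in> G \<longrightarrow> dist x xbar < e \<longrightarrow> dist x xbar \<le> c0 * dist x t"
    by blast
  have bound: "dist x xbar \<le> c0 * dist x t" if "x \<in> W" "t \<in> T x" "dist x xbar < e" for x t
    using bound_G that by (simp add: G_def)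
  \<comment> \<open>The region of the error bound is taken as a ball around \<open>xbar\<close>,
    since steps of \<open>T\<close> do not increase the distance to \<open>xbar\<close> and so
    cannot leave it.\<close>
  define N where "N = ball xbar e"
  have N: "xbar \<in> interior N"
    using e by (simp add: N_def)
  note subreg = metrically_subregular_id_minus_iff[OF fix_T]
  \<comment> \<open>A constant of subregularity may be enlarged; at least \<open>1\<close>, it makes
    the rate a number in the interval from \<open>0\<close> to \<open>1\<close>, with
    \<open>1\<close> excluded.\<close>
  define c1 where "c1 = max c0 1"
  have c1: "c1 \<ge> 1" "metrically_subregular (id_minus T) xbar 0 W c1 N"
  proof -
    have "dist x xbar \<le> c1 * dist x t" if "x \<in> N \<inter> W" "t \<in> T x" for x t
    proof -
      have "dist x xbar \<le> c0 * dist x t"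
        using that by (intro bound) (auto simp: N_def dist_commute)
      also have "\<dots> \<le> c1 * dist x t"
        by (intro mult_right_mono) (auto simp: c1_def)
      finally show ?thesis .
    qed
    then show "metrically_subregular (id_minus T) xbar 0 W c1 N"
      unfolding subreg using N by (auto simp: c1_def)
  qed (simp add: c1_def)

  have rate: "linear_rate x xbar (sqrt (1 - 1 / c\<^sup>2))"
    if x: "x 0 \<in> N \<inter> W" "\<And>k. x (Suc k) \<in> T (x k)"
      and c: "c \<ge> 1" "metrically_subregular (id_minus T) xbar 0 W c N" for x c
  proof (rule linear_rate_if_error_bound[OF c(1)])
    fix k
    show "(norm (x (Suc k) - xbar))\<^sup>2 \<le> (norm (x k - xbar))\<^sup>2 - (norm (x k - x (Suc k)))\<^sup>2"
      by (rule fne[OF x(2)])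
    have "x k \<in> N \<inter> W"
    proof (induction k)
      case (Suc k)
      then show ?case
        using W(2) x(2)[of k] nonexp[OF x(2)[of k]] by (auto simp: N_def dist_commute)
    qed (rule x(1))
    then show "norm (x k - xbar) \<le> c * norm (x k - x (Suc k))"
      using c(2) x(2)[of k] unfolding subreg by (auto simp: dist_norm)
  qed
  have rate_bounds: "0 \<le> sqrt (1 - 1 / c\<^sup>2)" "sqrt (1 - 1 / c\<^sup>2) < 1" if "c \<ge> 1" for c :: real
    using that by (auto simp: power2_eq_square divide_simps mult_ge1_I)
  have conv: "converges_linearly x xbar"
    if "x 0 \<in> N \<inter> W" "\<And>k. x (Suc k) \<in> T (x k)" for x
    using rate[OF that c1] rate_bounds[OF c1(1)] unfolding converges_linearly_def by blast

  have bb: "bb \<in> subdifferential (\<lambda>v. ereal (H v)) vb"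
    using vb subdifferential_conjugate_iff[OF H(1,3,4) ne(2)] by (simp add: D_def)
  have dual: "bb \<in> dual_solutions J H A"
    unfolding dual_solutions_def using vb wb by (intro Fermat_sum[of "- vb"]) (simp_all add: B_def D_def)
  \<comment> \<open>The primal partners of \<open>(bb, vb)\<close> in the KKT system. They solve the
    primal problem and also minimise the u-step at \<open>(bb, vb)\<close>.\<close>
  let ?S = "{x. A x = vb \<and> - adjoint A bb \<in> subdifferential J x}"
  have S_primal: "?S \<subseteq> primal_solutions J H A"
    using primal_solution_intro[OF A] bb by blast
  have S_step: "?S \<subseteq> admm_u_step J A \<eta> bb vb"
    using \<eta> by (auto simp: admm_u_step_iff_subgradient[OF J(1,3) A])

  have admm: "converges_linearly (\<lambda>k. (b k, v k)) (bb, vb) \<and> ?S \<noteq> {} \<and> (\<lambda>k. infdist (u k) ?S) \<longlonglongrightarrow> 0"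
    if v0: "v 0 \<in> D (b 0)" and x0: "b 0 + \<eta> *\<^sub>R v 0 \<in> N \<inter> W"
      and seq: "admm_sequence J H A \<eta> u v b" for u v b
  proof -
    have us: "u (Suc k) \<in> admm_u_step J A \<eta> (b k) (v k)"
      and vs: "v (Suc k) \<in> admm_v_step H A \<eta> (b k) (u (Suc k))"
      and bs: "b (Suc k) = b k + \<eta> *\<^sub>R (A (u (Suc k)) - v (Suc k))" for k
      using seq by (auto simp: admm_sequence_def)
    note step = admm_step_DR[OF J(1,3) H(1,3) A \<eta> _ us vs bs, folded B_def D_def, folded T_def]
    have v: "v k \<in> D (b k)" for k
      by (induction k) (auto intro: v0 step(2))
    let ?x = "\<lambda>k. b k + \<eta> *\<^sub>R v k"
    have "converges_linearly ?x xbar"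
      by (rule conv[OF x0 step(3)[OF v]])
    then obtain r L where r: "0 \<le> r" "r < 1" and L: "\<And>k. norm (?x k - xbar) \<le> L * r ^ k"
      by (auto simp: converges_linearly_def linear_rate_def)
    have "norm ((b k, v k) - (bb, vb)) \<le> ((1 + 1/\<eta>) * L) * r ^ k" for k
    proof -
      have "norm ((b k, v k) - (bb, vb)) \<le> (1 + 1/\<eta>) * norm (?x k - xbar)"
        unfolding xbar using v vb by (intro resolvent_parts_norm_le[OF \<eta>]) (auto simp: D_def)
      also have "\<dots> \<le> (1 + 1/\<eta>) * (L * r ^ k)"
        using L \<eta> by (intro mult_left_mono) auto
      finally show ?thesis
        by (simp add: mult.assoc)
    qed
    then have lin: "converges_linearly (\<lambda>k. (b k, v k)) (bb, vb)"
      unfolding converges_linearly_def linear_rate_def using r by blast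
    from tendsto_fst[OF converges_linearly_tendsto[OF lin]]
      tendsto_snd[OF converges_linearly_tendsto[OF lin]]
    have bl: "b \<longlonglongrightarrow> bb" and vl: "v \<longlonglongrightarrow> vb"
      by simp_all
    \<comment> \<open>By \<open>admm_step_DR\<close>, this combination is the multiplier at which
      \<open>u (Suc k)\<close> satisfies its optimality condition.\<close>
    have lim: "(\<lambda>k. b (Suc k) + \<eta> *\<^sub>R (v (Suc k) - v k)) \<longlonglongrightarrow> bb + \<eta> *\<^sub>R (vb - vb)"
      by (intro tendsto_intros LIMSEQ_Suc bl vl)
    have "bounded_linear (adjoint A)"
      using adjoint_linear[OF A] by (simp add: linear_conv_bounded_linear)
    from tendsto_minus[OF bounded_linear.tendsto[OF this lim]]
    have sl: "(\<lambda>k. - adjoint A (b (Suc k) + \<eta> *\<^sub>R (v (Suc k) - v k))) \<longlonglongrightarrow> - adjoint A bb"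
      by simp
    \<comment> \<open>Solving the multiplier update for \<open>A (u (Suc k))\<close> expresses it
      through convergent sequences.\<close>
    have "(\<lambda>k. (1/\<eta>) *\<^sub>R (b (Suc k) - b k) + v (Suc k)) \<longlonglongrightarrow> (1/\<eta>) *\<^sub>R (bb - bb) + vb"
      by (intro tendsto_intros LIMSEQ_Suc bl vl)
    moreover have "(1/\<eta>) *\<^sub>R (b (Suc k) - b k) + v (Suc k) = A (u (Suc k))" for k
      using \<eta> by (simp add: bs)
    ultimately have Al: "(\<lambda>k. A (u (Suc k))) \<longlonglongrightarrow> vb"
      by simp
    \<comment> \<open>\<open>u 0\<close> is arbitrary, so the subgradient relation is available only
      for the shifted sequence.\<close>
    have "?S \<noteq> {}" "(\<lambda>k. infdist (u (Suc k)) ?S) \<longlonglongrightarrow> 0"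
      using primal_iterates_approach[OF J A step(1)[OF v] Al sl] by blast+
    then show ?thesis
      using lin LIMSEQ_imp_Suc[of "\<lambda>k. infdist (u k) ?S" 0] by blast
  qed

  have resolvent: "resolvent (scale_map \<eta> D) (b + \<eta> *\<^sub>R v) = {b}" if "v \<in> D b" for b v
    using that \<eta> unfolding D_def by (intro resolvent_subdifferential_eq) auto
  have ex_c: "\<exists>c\<ge>1. metrically_subregular (id_minus T) xbar 0 W c N"
    using c1 by blast
  show ?thesis
  proof (rule exI[of _ N], rule conjI[OF N], rule conjI[OF ex_c], rule exI[of _ bb], rule exI[of _ vb],
      intro conjI allI impI; (elim conjE)?)
    show "resolvent (scale_map \<eta> D) xbar = {bb}"
      unfolding xbar by (rule resolvent[OF vb])
    show "vb = (1/\<eta>) *\<^sub>R (xbar - bb)"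
      using \<eta> by (simp add: xbar)
    show "bb \<in> dual_solutions J H A"
      by (rule dual)
  next
    fix x0 v0 b0 assume "v0 \<in> D b0" "x0 = b0 + \<eta> *\<^sub>R v0"
    then show "resolvent (scale_map \<eta> D) x0 = {b0}"
      using resolvent by blast
  next
    fix x0 x assume "x0 \<in> N \<inter> W" "x 0 = x0" "\<forall>k. x (Suc k) \<in> T (x k)"
    then show "converges_linearly x xbar"
      by (intro conv) auto
  next
    fix x0 x and c :: real
    assume "x0 \<in> N \<inter> W" "x 0 = x0" "\<forall>k. x (Suc k) \<in> T (x k)"
      and c: "1 \<le> c" "metrically_subregular (id_minus T) xbar 0 W c N"
    then have "linear_rate x xbar (sqrt (1 - 1 / c\<^sup>2))"
      by (intro rate) auto
    then show "\<exists>r\<ge>0. r \<le> sqrt (1 - 1 / c\<^sup>2) \<and> linear_rate x xbar r"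
      using rate_bounds[OF c(1)] by blast
  next
    fix x0 v0 b0 and u :: "nat \<Rightarrow> 'u" and v b
    assume asm: "v0 \<in> D b0" "x0 = b0 + \<eta> *\<^sub>R v0" "x0 \<in> N \<inter> W" "v 0 = v0" "b 0 = b0"
      and "admm_sequence J H A \<eta> u v b"
    then have *: "converges_linearly (\<lambda>k. (b k, v k)) (bb, vb)" "?S \<noteq> {}" "(\<lambda>k. infdist (u k) ?S) \<longlonglongrightarrow> 0"
      using admm[of v b u] by auto
    show "converges_linearly (\<lambda>k. (b k, v k)) (bb, vb)"
      by (rule *(1))
    show "primal_solutions J H A \<noteq> {}"
      using *(2) S_primal by blast
    show "(\<lambda>k. infdist (u k) (primal_solutions J H A)) \<longlonglongrightarrow> 0"
    proof (rule Lim_null_comparison[OF _ *(3)])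
      show "\<forall>\<^sub>F k in sequentially. norm (infdist (u k) (primal_solutions J H A)) \<le> infdist (u k) ?S"
        using infdist_mono[OF S_primal *(2)] by (simp add: infdist_nonneg)
    qed
    assume unique: "\<forall>u1 u2. u1 \<in> admm_u_step J A \<eta> bb vb \<and> u2 \<in> admm_u_step J A \<eta> bb vb \<longrightarrow> u1 = u2"
    obtain ubar where "ubar \<in> ?S"
      using *(2) by blast
    \<comment> \<open>\<open>?S\<close> is nonempty and contained in the set of u-step minimisers at
      the limit, so uniqueness there makes it a singleton, and the distance to \<open>?S\<close>
      becomes the distance to a point.\<close>
    then have S: "?S = {ubar}"
      using unique S_step by blast
    have "(\<lambda>k. dist (u k) ubar) \<longlonglongrightarrow> 0"
      using *(3) unfolding S by simp
    then have "u \<longlonglongrightarrow> ubar"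
      by (rule tendsto_dist_iff[THEN iffD2])
    then show "\<exists>ubar\<in>primal_solutions J H A. u \<longlonglongrightarrow> ubar"
      using S S_primal by blast
  qed
qed

end
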